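(* Let $K$ be a field and let $E=(E^0,E^1,r,s)$ be a graph. Write $E^0=\left(\bigsqcup_{i\in\Delta}Z_i\right)\sqcup R$ (disjoint union), where each $Z_i$ is connected (the $Z_i$ being the connected components of the set of non-isolated vertices) and $R$ is the set of isolated vertices. For each $i\in\Delta$ let $E_i$ be the graph with vertex set $Z_i$, edge set $r^{-1}(Z_i)\cup s^{-1}(Z_i)$ and the restrictions of $r,s$, and let $X_n^{(i)}$ denote the set of level $n$ vertices of $E_i$. Suppose that for each $i\in\Delta$ there is a positive integer $m_i$ such that $Z_i=\bigcup_{n=1}^{m_i}X_n^{(i)}$ or $Z_i=\bigcup_{n=1}^{m_i}X_n^{(i)}\cup\{\overline{v_i}\}$ for some vertex $\overline{v_i}$ (for example, this holds if each graph $E_i$ is $P$-simple and each $Z_i$ is finite). Let $V$ be a $K$-module, let $\Phi:L_K(E)\to\mathrm{Hom}_K(V)$ be a representation, with $V_u,V_e,\overline{V_u},W,\overline{V},\Phi_1$ as in the context, and suppose $\Phi(e^* )(\overline{V_{s(e)}})=0$ for each $e\in E^1$. Then: 1. The representation $\Phi_1$ (the restriction of $\Phi$ to $W$) is equivalent to a representation induced by an $E$-algebraic branching system. 2. If $\Phi(u)(\overline{V})=0$ for each $u\in E^0$, then $\Phi$ is equivalent to a representation induced by an $E$-algebraic branching system.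
   Context: A graph $E=(E^0,E^1,r,s)$ is a directed graph with countable vertex set $E^0$, countable edge set $E^1$, and range and source maps $r,s:E^1\to E^0$. Connectedness. A path without orientation between $u,v\in E^0$ is a pair of sequences $(u_0u_1\dots u_n;e_1\dots e_n)$ of vertices and edges with $u=u_0$, $v=u_n$, $e_i\ne e_j$ for $i\neq j$, and for each $i$ either $s(e_i)=u_{i-1}$ and $r(e_i)=u_i$, or $r(e_i)=u_{i-1}$ and $s(e_i)=u_i$. A set $Z\subseteq E^0$ is connected if for any $u,v\in Z$ there is a path without orientation between $u$ and $v$. An isolated vertex is one that is neither the source nor the range of any edge. A graph $F=(F^0,F^1,r,s)$ is $P$-simple if for all $u\neq v$ in $r(F^1)\cup s(F^1)$ there is at most one path without orientation between $u$ and $v$, and moreover there is no edge $e\in F^1$ with $r(e)=s(e)$. Levels. A vertex $v$ of a graph $F$ is an extreme vertex if $\#(r^{-1}(v)\cup s^{-1}(v))=1$ and there is no edge $e$ with $r(e)=v=s(e)$; the unique edge adjacent to an extreme vertex is an extreme edge. Let $X_1$ (level 1 vertices) and $Y_1$ (level 1 edges) be the sets of extreme vertices and extreme edges of $F$. Removing $X_1$ from the vertices and $Y_1$ from the edges gives a new graph, whose sets of extreme vertices and extreme edges are $X_2$ and $Y_2$ (level 2). Proceeding inductively one defines the set $X_n$ of level $n$ vertices and the set $Y_n$ of level $n$ edges, if such vertices and edges exist. The Leavitt path algebra $L_K(E)$ is the universal $K$-algebra generated by a set $\{v:v\in E^0\}$ of pairwise orthogonal idempotents together with a set $\{e,e^*:e\in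 E^1\}$ of elements satisfying: (1) $s(e)e=er(e)=e$ for all $e\in E^1$; (2) $r(e)e^*=e^*s(e)=e^*$ for all $e\in E^1$; (3) $e^*f=\delta_{e,f}r(e)$ for all $e,f\in E^1$; (4) $v=\sum_{e:s(e)=v}ee^*$ for every vertex $v$ with $0<\#\{e:s(e)=v\}<\infty$. A representation is a $K$-algebra homomorphism $L_K(E)\to\mathrm{Hom}_K(V)$, where $\mathrm{Hom}_K(V)$ is the $K$-algebra of $K$-linear maps $V\to V$ under composition. An $E$-algebraic branching system consists of a set $X$, subsets $R_e$ ($e\in E^1$) and $D_v$ ($v\in E^0$) of $X$, and maps $f_e$ ($e\in E^1$) such that: the $R_e$ are pairwise disjoint; the $D_v$ are pairwise disjoint; $R_e\subseteq D_{s(e)}$; $D_v=\bigcup_{e:s(e)=v}R_e$ if $0<\#\{e:s(e)=v\}<\infty$; and each $f_e:D_{r(e)}\to R_e$ is a bijection. The representation it induces is here the homomorphism $\pi:L_K(E)\to \mathrm{Hom}_K(M)$, where $M$ is the $K$-module of functions $X\to K$ that are nonzero at only finitely many points, determined by: $\pi(e)(\phi)(x)=\phi(f_e^{-1}(x))$ if $x\in R_e$ and $0$ otherwise; $\pi(e^* )(\phi)(x)=\phi(f_e(x))$ if $x\in D_{r(e)}$ and $0$ otherwise; $\pi(v)(\phi)(x)=\phi(x)$ if $x\in D_v$ and $0$ otherwise. Subspaces. $V_u=\Phi(u)(V)$ for $u\in E^0$ and $V_e=\Phi(e)\Phi(e^* )(V)$ for $e\in E^1$. If $\#\{e:s(e)=u\}=\infty$,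 $\overline{V_u}$ is a chosen $K$-submodule of $V_u$ with $V_u=\left(\bigoplus_{e:s(e)=u}V_e\right)\oplus\overline{V_u}$. If $0<\#\{e:s(e)=u\}<\infty$ then $V_u=\bigoplus_{e:s(e)=u}V_e$, and the condition $\Phi(e^* )(\overline{V_{s(e)}})=0$ for edges $e$ with $s(e)=u$ is regarded as vacuous. Put $W=\bigoplus_{u\in E^0}V_u\subseteq V$, and let $\overline{V}$ be a chosen $K$-submodule with $V=W\oplus\overline{V}$. Since $\Phi(a)(V)\subseteq W$ for all $a\in L_K(E)$, $\Phi$ restricts to a representation $\Phi_1:L_K(E)\to\mathrm{Hom}_K(W)$, $\Phi_1(a)=\Phi(a)|_W$. Equivalence. Representations $\pi:L_K(E)\to\mathrm{Hom}_K(M)$ and $\Psi:L_K(E)\to\mathrm{Hom}_K(W')$, where $M$ and $W'$ are $K$-modules, are equivalent if there is a $K$-module isomorphism $U:W'\to M$ with $U\circ\Psi(a)=\pi(a)\circ U$ for every $a\in L_K(E)$.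
   Formalization: E is also assumed to have no edge e with r(e)=s(e): for one vertex with one loop acting as multiplication by 2 on the rationals, the statement as given is false. The parenthetical example (P-simple E_i with finite Z_i) is not included. *)

theory Defs
  imports
    "Graph_Theory.Digraph"
    "HOL-Library.Poly_Mapping"
    "HOL-Library.Countable_Set"
    "HOL-Library.Disjoint_Sets"
    "HOL-Library.FuncSet"
begin

text \<open>
  Graphs $E = (E^0, E^1, r, s)$ are directed multigraphs of type
  \<^typ>\<open>('v, 'e) pre_digraph\<close> with $E^0$ = \<^const>\<open>verts\<close>, $E^1$ = \<^const>\<open>arcs\<close>,
  $s$ = \<^const>\<open>tail\<close> and $r$ = \<^const>\<open>head\<close>. Thus $s^{-1}(v)$ is \<^term>\<open>out_arcs E v\<close>
  and $r^{-1}(v)$ is \<^term>\<open>in_arcs E v\<close>.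
\<close>

section \<open>Connectedness and levels\<close>

definition unoriented_path ::
  "('v, 'e) pre_digraph \<Rightarrow> 'v \<Rightarrow> 'v list \<Rightarrow> 'e list \<Rightarrow> 'v \<Rightarrow> bool" where
  "unoriented_path E u us es v \<longleftrightarrow>
     length us = Suc (length es) \<and> hd us = u \<and> last us = v \<and>
     set us \<subseteq> verts E \<and> set es \<subseteq> arcs E \<and> distinct es \<and>
     (\<forall>i < length es.
        (tail E (es ! i) = us ! i \<and> head E (es ! i) = us ! Suc i) \<or>
        (head E (es ! i) = us ! i \<and> tail E (es ! i) = us ! Suc i))"

definition unoriented_connected :: "('v, 'e) pre_digraph \<Rightarrow> 'v set \<Rightarrow> bool" where
  "unoriented_connected E Z \<longleftrightarrow>
     Z \<subseteq> verts E \<and> (\<forall>u\<in>Z. \<forall>v\<in>Z. \<exists>us es. unoriented_path E u us es v)"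

definition isolated_verts :: "('v, 'e) pre_digraph \<Rightarrow> 'v set" where
  "isolated_verts E = {v \<in> verts E. in_arcs E v = {} \<and> out_arcs E v = {}}"

definition is_component :: "('v, 'e) pre_digraph \<Rightarrow> 'v set \<Rightarrow> bool" where
  "is_component E Z \<longleftrightarrow>
     Z \<noteq> {} \<and> Z \<subseteq> verts E - isolated_verts E \<and> unoriented_connected E Z \<and>
     (\<forall>Z'. Z \<subseteq> Z' \<and> Z' \<subseteq> verts E - isolated_verts E \<and> unoriented_connected E Z' \<longrightarrow> Z' = Z)"

definition component_graph :: "('v, 'e) pre_digraph \<Rightarrow> 'v set \<Rightarrow> ('v, 'e) pre_digraph" where
  "component_graph E Z =
     \<lparr>verts = Z, arcs = {e \<in> arcs E. head E e \<in> Z \<or> tail E e \<in> Z}, tail = tail E, head = head E\<rparr>"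

definition extreme_verts :: "('v, 'e) pre_digraph \<Rightarrow> 'v set" where
  "extreme_verts F =
     {v \<in> verts F. card (in_arcs F v \<union> out_arcs F v) = 1 \<and>
                   \<not> (\<exists>e\<in>arcs F. head F e = v \<and> tail F e = v)}"

definition extreme_arcs :: "('v, 'e) pre_digraph \<Rightarrow> 'e set" where
  "extreme_arcs F = (\<Union>v\<in>extreme_verts F. in_arcs F v \<union> out_arcs F v)"

definition remove_extreme :: "('v, 'e) pre_digraph \<Rightarrow> ('v, 'e) pre_digraph" where
  "remove_extreme F =
     \<lparr>verts = verts F - extreme_verts F, arcs = arcs F - extreme_arcs F,
      tail = tail F, head = head F\<rparr>"

text \<open>Levels are numbered from $1$; the value at $0$ is never used.\<close>

definition level_verts :: "('v, 'e) pre_digraph \<Rightarrow> nat \<Rightarrow> 'v set" where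
  "level_verts F n = extreme_verts ((remove_extreme ^^ (n - 1)) F)"


section \<open>Leavitt path algebras\<close>

text \<open>
  $L_K(E)$ is the (not necessarily unital) associative $K$-algebra presented by generators and
  relations: terms over the generators modulo the least congruence that contains the axioms of
  $K$-algebras and the defining relations. The field $K$ is the type \<^typ>\<open>'k\<close>.
\<close>

datatype ('k, 'v, 'e) lpa_term =
    Vertex 'v
  | Edge 'e
  | Ghost 'e
  | Zero
  | Plus "('k, 'v, 'e) lpa_term" "('k, 'v, 'e) lpa_term"
  | Scale 'k "('k, 'v, 'e) lpa_term"
  | Times "('k, 'v, 'e) lpa_term" "('k, 'v, 'e) lpa_term"

inductive_set lpa_terms :: "('v, 'e) pre_digraph \<Rightarrow> ('k, 'v, 'e) lpa_term set"
  for E :: "('v, 'e) pre_digraph" where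
  Vertex: "v \<in> verts E \<Longrightarrow> Vertex v \<in> lpa_terms E"
| Edge: "e \<in> arcs E \<Longrightarrow> Edge e \<in> lpa_terms E"
| Ghost: "e \<in> arcs E \<Longrightarrow> Ghost e \<in> lpa_terms E"
| Zero: "Zero \<in> lpa_terms E"
| Plus: "a \<in> lpa_terms E \<Longrightarrow> b \<in> lpa_terms E \<Longrightarrow> Plus a b \<in> lpa_terms E"
| Scale: "a \<in> lpa_terms E \<Longrightarrow> Scale k a \<in> lpa_terms E"
| Times: "a \<in> lpa_terms E \<Longrightarrow> b \<in> lpa_terms E \<Longrightarrow> Times a b \<in> lpa_terms E"

inductive lpa_eq ::
  "('v, 'e) pre_digraph \<Rightarrow> ('k::field, 'v, 'e) lpa_term \<Rightarrow> ('k, 'v, 'e) lpa_term \<Rightarrow> bool"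
  for E :: "('v, 'e) pre_digraph" where
  \<comment> \<open>congruence\<close>
  refl: "a \<in> lpa_terms E \<Longrightarrow> lpa_eq E a a"
| sym: "lpa_eq E a b \<Longrightarrow> lpa_eq E b a"
| trans: "lpa_eq E a b \<Longrightarrow> lpa_eq E b c \<Longrightarrow> lpa_eq E a c"
| Plus_cong: "lpa_eq E a a' \<Longrightarrow> lpa_eq E b b' \<Longrightarrow> lpa_eq E (Plus a b) (Plus a' b')"
| Scale_cong: "lpa_eq E a a' \<Longrightarrow> lpa_eq E (Scale k a) (Scale k a')"
| Times_cong: "lpa_eq E a a' \<Longrightarrow> lpa_eq E b b' \<Longrightarrow> lpa_eq E (Times a b) (Times a' b')"
  \<comment> \<open>vector space axioms\<close>
| Plus_assoc: "{a, b, c} \<subseteq> lpa_terms E \<Longrightarrow> lpa_eq E (Plus (Plus a b) c) (Plus a (Plus b c))"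
| Plus_commute: "{a, b} \<subseteq> lpa_terms E \<Longrightarrow> lpa_eq E (Plus a b) (Plus b a)"
| Plus_Zero: "a \<in> lpa_terms E \<Longrightarrow> lpa_eq E (Plus a Zero) a"
| Plus_uminus: "a \<in> lpa_terms E \<Longrightarrow> lpa_eq E (Plus a (Scale (- 1) a)) Zero"
| Scale_Plus: "{a, b} \<subseteq> lpa_terms E \<Longrightarrow>
    lpa_eq E (Scale k (Plus a b)) (Plus (Scale k a) (Scale k b))"
| Scale_add: "a \<in> lpa_terms E \<Longrightarrow> lpa_eq E (Scale (k + l) a) (Plus (Scale k a) (Scale l a))"
| Scale_Scale: "a \<in> lpa_terms E \<Longrightarrow> lpa_eq E (Scale k (Scale l a)) (Scale (k * l) a)"
| Scale_one: "a \<in> lpa_terms E \<Longrightarrow> lpa_eq E (Scale 1 a) a"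
  \<comment> \<open>associative bilinear multiplication\<close>
| Times_assoc: "{a, b, c} \<subseteq> lpa_terms E \<Longrightarrow> lpa_eq E (Times (Times a b) c) (Times a (Times b c))"
| Times_Plus_left: "{a, b, c} \<subseteq> lpa_terms E \<Longrightarrow>
    lpa_eq E (Times (Plus a b) c) (Plus (Times a c) (Times b c))"
| Times_Plus_right: "{a, b, c} \<subseteq> lpa_terms E \<Longrightarrow>
    lpa_eq E (Times a (Plus b c)) (Plus (Times a b) (Times a c))"
| Times_Scale_left: "{a, b} \<subseteq> lpa_terms E \<Longrightarrow>
    lpa_eq E (Times (Scale k a) b) (Scale k (Times a b))"
| Times_Scale_right: "{a, b} \<subseteq> lpa_terms E \<Longrightarrow>
    lpa_eq E (Times a (Scale k b)) (Scale k (Times a b))"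
  \<comment> \<open>defining relations of the Leavitt path algebra\<close>
| Vertex_idem: "v \<in> verts E \<Longrightarrow> lpa_eq E (Times (Vertex v) (Vertex v)) (Vertex v)"
| Vertex_orthogonal: "v \<in> verts E \<Longrightarrow> w \<in> verts E \<Longrightarrow> v \<noteq> w \<Longrightarrow>
    lpa_eq E (Times (Vertex v) (Vertex w)) Zero"
| tail_Edge: "e \<in> arcs E \<Longrightarrow> tail E e \<in> verts E \<Longrightarrow>
    lpa_eq E (Times (Vertex (tail E e)) (Edge e)) (Edge e)"
| Edge_head: "e \<in> arcs E \<Longrightarrow> head E e \<in> verts E \<Longrightarrow>
    lpa_eq E (Times (Edge e) (Vertex (head E e))) (Edge e)"
| head_Ghost: "e \<in> arcs E \<Longrightarrow> head E e \<in> verts E \<Longrightarrow>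
    lpa_eq E (Times (Vertex (head E e)) (Ghost e)) (Ghost e)"
| Ghost_tail: "e \<in> arcs E \<Longrightarrow> tail E e \<in> verts E \<Longrightarrow>
    lpa_eq E (Times (Ghost e) (Vertex (tail E e))) (Ghost e)"
| Ghost_Edge_same: "e \<in> arcs E \<Longrightarrow> head E e \<in> verts E \<Longrightarrow>
    lpa_eq E (Times (Ghost e) (Edge e)) (Vertex (head E e))"
| Ghost_Edge_diff: "e \<in> arcs E \<Longrightarrow> f \<in> arcs E \<Longrightarrow> e \<noteq> f \<Longrightarrow>
    lpa_eq E (Times (Ghost e) (Edge f)) Zero"
  \<comment> \<open>the list \<open>es\<close> enumerates the nonempty finite set of arcs emitted by \<open>v\<close>\<close>
| Vertex_sum: "v \<in> verts E \<Longrightarrow> distinct es \<Longrightarrow> set es = out_arcs E v \<Longrightarrow> es \<noteq> [] \<Longrightarrow>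
    lpa_eq E (Vertex v) (foldr (\<lambda>e. Plus (Times (Edge e) (Ghost e))) es Zero)"

definition lpa_rel ::
  "('v, 'e) pre_digraph \<Rightarrow> (('k::field, 'v, 'e) lpa_term \<times> ('k, 'v, 'e) lpa_term) set" where
  "lpa_rel E = {(a, b). lpa_eq E a b}"

definition lpa :: "('v, 'e) pre_digraph \<Rightarrow> ('k::field, 'v, 'e) lpa_term set set" where
  "lpa E = lpa_terms E // lpa_rel E"

definition lpa_class ::
  "('v, 'e) pre_digraph \<Rightarrow> ('k::field, 'v, 'e) lpa_term \<Rightarrow> ('k, 'v, 'e) lpa_term set" where
  "lpa_class E a = lpa_rel E `` {a}"

definition lpa_plus ::
  "('v, 'e) pre_digraph \<Rightarrow> ('k::field, 'v, 'e) lpa_term set \<Rightarrow> ('k, 'v, 'e) lpa_term set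
     \<Rightarrow> ('k, 'v, 'e) lpa_term set" where
  "lpa_plus E A B = (\<Union>a\<in>A. \<Union>b\<in>B. lpa_class E (Plus a b))"

definition lpa_scale ::
  "('v, 'e) pre_digraph \<Rightarrow> 'k::field \<Rightarrow> ('k, 'v, 'e) lpa_term set \<Rightarrow> ('k, 'v, 'e) lpa_term set" where
  "lpa_scale E k A = (\<Union>a\<in>A. lpa_class E (Scale k a))"

definition lpa_times ::
  "('v, 'e) pre_digraph \<Rightarrow> ('k::field, 'v, 'e) lpa_term set \<Rightarrow> ('k, 'v, 'e) lpa_term set
     \<Rightarrow> ('k, 'v, 'e) lpa_term set" where
  "lpa_times E A B = (\<Union>a\<in>A. \<Union>b\<in>B. lpa_class E (Times a b))"

abbreviation lpa_vertex ::
  "('v, 'e) pre_digraph \<Rightarrow> 'v \<Rightarrow> ('k::field, 'v, 'e) lpa_term set" where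
  "lpa_vertex E v \<equiv> lpa_class E (Vertex v)"

abbreviation lpa_edge ::
  "('v, 'e) pre_digraph \<Rightarrow> 'e \<Rightarrow> ('k::field, 'v, 'e) lpa_term set" where
  "lpa_edge E e \<equiv> lpa_class E (Edge e)"

abbreviation lpa_ghost ::
  "('v, 'e) pre_digraph \<Rightarrow> 'e \<Rightarrow> ('k::field, 'v, 'e) lpa_term set" where
  "lpa_ghost E e \<equiv> lpa_class E (Ghost e)"


section \<open>Representations\<close>

text \<open>
  A $K$-module is a subspace \<open>M\<close> of a vector space given by the scalar multiplication \<open>sc\<close> on a
  type. Functions are only considered on \<open>M\<close>; their values elsewhere are irrelevant.
\<close>

definition linear_map_on ::
  "('k \<Rightarrow> 'a::ab_group_add \<Rightarrow> 'a) \<Rightarrow> 'a set \<Rightarrow> ('k \<Rightarrow> 'b::ab_group_add \<Rightarrow> 'b) \<Rightarrow> 'b set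
     \<Rightarrow> ('a \<Rightarrow> 'b) \<Rightarrow> bool" where
  "linear_map_on sc M sc' M' f \<longleftrightarrow>
     f ` M \<subseteq> M' \<and> (\<forall>x\<in>M. \<forall>y\<in>M. f (x + y) = f x + f y) \<and> (\<forall>k. \<forall>x\<in>M. f (sc k x) = sc' k (f x))"

definition lpa_rep ::
  "('v, 'e) pre_digraph \<Rightarrow> ('k::field \<Rightarrow> 'a::ab_group_add \<Rightarrow> 'a) \<Rightarrow> 'a set
     \<Rightarrow> (('k, 'v, 'e) lpa_term set \<Rightarrow> 'a \<Rightarrow> 'a) \<Rightarrow> bool" where
  "lpa_rep E sc M \<Phi> \<longleftrightarrow>
     (\<forall>a\<in>lpa E. linear_map_on sc M sc M (\<Phi> a)) \<and>
     (\<forall>a\<in>lpa E. \<forall>b\<in>lpa E. \<forall>x\<in>M. \<Phi> (lpa_plus E a b) x = \<Phi> a x + \<Phi> b x) \<and>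
     (\<forall>k. \<forall>a\<in>lpa E. \<forall>x\<in>M. \<Phi> (lpa_scale E k a) x = sc k (\<Phi> a x)) \<and>
     (\<forall>a\<in>lpa E. \<forall>b\<in>lpa E. \<forall>x\<in>M. \<Phi> (lpa_times E a b) x = \<Phi> a (\<Phi> b x))"

definition equivalent_reps ::
  "('v, 'e) pre_digraph
     \<Rightarrow> ('k::field \<Rightarrow> 'a::ab_group_add \<Rightarrow> 'a) \<Rightarrow> 'a set \<Rightarrow> (('k, 'v, 'e) lpa_term set \<Rightarrow> 'a \<Rightarrow> 'a)
     \<Rightarrow> ('k \<Rightarrow> 'b::ab_group_add \<Rightarrow> 'b) \<Rightarrow> 'b set \<Rightarrow> (('k, 'v, 'e) lpa_term set \<Rightarrow> 'b \<Rightarrow> 'b) \<Rightarrow> bool"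
  where
  "equivalent_reps E sc M \<pi> sc' W \<Psi> \<longleftrightarrow>
     (\<exists>U. linear_map_on sc' W sc M U \<and> bij_betw U W M \<and>
          (\<forall>a\<in>lpa E. \<forall>x\<in>W. U (\<Psi> a x) = \<pi> a (U x)))"

definition vertex_space ::
  "('v, 'e) pre_digraph \<Rightarrow> (('k::field, 'v, 'e) lpa_term set \<Rightarrow> 'a \<Rightarrow> 'a) \<Rightarrow> 'v \<Rightarrow> 'a set" where
  "vertex_space E \<Phi> u = range (\<Phi> (lpa_vertex E u))"

definition edge_space ::
  "('v, 'e) pre_digraph \<Rightarrow> (('k::field, 'v, 'e) lpa_term set \<Rightarrow> 'a \<Rightarrow> 'a) \<Rightarrow> 'e \<Rightarrow> 'a set" where
  "edge_space E \<Phi> e = range (\<lambda>x. \<Phi> (lpa_edge E e) (\<Phi> (lpa_ghost E e) x))"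

text \<open>
  Internal sums of subspaces. That the sums of the \<open>vertex_space\<close>s and of the
  \<open>edge_space\<close>s are direct is automatic and proved below.
\<close>

definition subspace_sum ::
  "('k::field \<Rightarrow> 'a::ab_group_add \<Rightarrow> 'a) \<Rightarrow> 'i set \<Rightarrow> ('i \<Rightarrow> 'a set) \<Rightarrow> 'a set" where
  "subspace_sum sc I A = module.span sc (\<Union>i\<in>I. A i)"

definition independent_family :: "'i set \<Rightarrow> ('i \<Rightarrow> 'a::ab_group_add set) \<Rightarrow> bool" where
  "independent_family I A \<longleftrightarrow>
     (\<forall>J x. finite J \<and> J \<subseteq> I \<and> (\<forall>j\<in>J. x j \<in> A j) \<and> (\<Sum>j\<in>J. x j) = 0 \<longrightarrow> (\<forall>j\<in>J. x j = 0))"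

definition is_complement ::
  "('k::field \<Rightarrow> 'a::ab_group_add \<Rightarrow> 'a) \<Rightarrow> 'a set \<Rightarrow> 'a set \<Rightarrow> 'a set \<Rightarrow> bool" where
  "is_complement sc A B S \<longleftrightarrow>
     module.subspace sc A \<and> module.subspace sc B \<and> S = {a + b |a b. a \<in> A \<and> b \<in> B} \<and> A \<inter> B = {0}"

definition rep_support ::
  "('v, 'e) pre_digraph \<Rightarrow> ('k::field \<Rightarrow> 'a::ab_group_add \<Rightarrow> 'a)
     \<Rightarrow> (('k, 'v, 'e) lpa_term set \<Rightarrow> 'a \<Rightarrow> 'a) \<Rightarrow> 'a set" where
  "rep_support E sc \<Phi> = subspace_sum sc (verts E) (vertex_space E \<Phi>)"

definition restricted_rep ::
  "(('k, 'v, 'e) lpa_term set \<Rightarrow> 'a \<Rightarrow> 'a) \<Rightarrow> 'a set \<Rightarrow> ('k, 'v, 'e) lpa_term set \<Rightarrow> 'a \<Rightarrow> 'a" where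
  "restricted_rep \<Phi> W a = restrict (\<Phi> a) W"


section \<open>Algebraic branching systems\<close>

definition algebraic_branching_system ::
  "('v, 'e) pre_digraph \<Rightarrow> 'x set \<Rightarrow> ('e \<Rightarrow> 'x set) \<Rightarrow> ('v \<Rightarrow> 'x set) \<Rightarrow> ('e \<Rightarrow> 'x \<Rightarrow> 'x) \<Rightarrow> bool" where
  "algebraic_branching_system E X R D f \<longleftrightarrow>
     (\<forall>e\<in>arcs E. R e \<subseteq> X) \<and> (\<forall>v\<in>verts E. D v \<subseteq> X) \<and>
     disjoint_family_on R (arcs E) \<and> disjoint_family_on D (verts E) \<and>
     (\<forall>e\<in>arcs E. R e \<subseteq> D (tail E e)) \<and>
     (\<forall>v\<in>verts E. finite (out_arcs E v) \<and> out_arcs E v \<noteq> {} \<longrightarrow> D v = (\<Union>e\<in>out_arcs E v. R e)) \<and>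
     (\<forall>e\<in>arcs E. bij_betw (f e) (D (head E e)) (R e))"

text \<open>The $K$-module of functions \<open>X \<rightarrow> K\<close> with finite support.\<close>

definition finsupp_module :: "'x set \<Rightarrow> ('x \<Rightarrow>\<^sub>0 'k::field) set" where
  "finsupp_module X = {\<phi>. Poly_Mapping.keys \<phi> \<subseteq> X}"

definition finsupp_scale :: "'k::field \<Rightarrow> ('x \<Rightarrow>\<^sub>0 'k) \<Rightarrow> ('x \<Rightarrow>\<^sub>0 'k)" where
  "finsupp_scale k \<phi> = Poly_Mapping.map (\<lambda>c. k * c) \<phi>"

definition is_induced_rep ::
  "('v, 'e) pre_digraph \<Rightarrow> 'x set \<Rightarrow> ('e \<Rightarrow> 'x set) \<Rightarrow> ('v \<Rightarrow> 'x set) \<Rightarrow> ('e \<Rightarrow> 'x \<Rightarrow> 'x)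
     \<Rightarrow> (('k::field, 'v, 'e) lpa_term set \<Rightarrow> ('x \<Rightarrow>\<^sub>0 'k) \<Rightarrow> ('x \<Rightarrow>\<^sub>0 'k)) \<Rightarrow> bool" where
  "is_induced_rep E X R D f \<pi> \<longleftrightarrow>
     lpa_rep E finsupp_scale (finsupp_module X) \<pi> \<and>
     (\<forall>e\<in>arcs E. \<forall>\<phi>\<in>finsupp_module X. \<forall>x\<in>X. Poly_Mapping.lookup (\<pi> (lpa_edge E e) \<phi>) x =
        (if x \<in> R e then Poly_Mapping.lookup \<phi> (the_inv_into (D (head E e)) (f e) x) else 0)) \<and>
     (\<forall>e\<in>arcs E. \<forall>\<phi>\<in>finsupp_module X. \<forall>x\<in>X. Poly_Mapping.lookup (\<pi> (lpa_ghost E e) \<phi>) x =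
        (if x \<in> D (head E e) then Poly_Mapping.lookup \<phi> (f e x) else 0)) \<and>
     (\<forall>v\<in>verts E. \<forall>\<phi>\<in>finsupp_module X. \<forall>x\<in>X. Poly_Mapping.lookup (\<pi> (lpa_vertex E v) \<phi>) x =
        (if x \<in> D v then Poly_Mapping.lookup \<phi> x else 0))"


section \<open>Sanity checks\<close>

lemma lpa_terms_foldr:
  "set es \<subseteq> arcs E \<Longrightarrow> foldr (\<lambda>e. Plus (Times (Edge e) (Ghost e))) es Zero \<in> lpa_terms E"
  by (induction es) (auto intro: lpa_terms.intros)

lemma lpa_eq_terms:
  assumes "lpa_eq E a b"
  shows "a \<in> lpa_terms E \<and> b \<in> lpa_terms E"
  using assms
  by induction (auto intro!: lpa_terms.intros lpa_terms_foldr simp: out_arcs_def)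

lemma equiv_lpa_rel: "equiv (lpa_terms E) (lpa_rel E)"
proof (rule equivI)
  show "lpa_rel E \<subseteq> lpa_terms E \<times> lpa_terms E"
    using lpa_eq_terms by (auto simp: lpa_rel_def)
  show "refl_on (lpa_terms E) (lpa_rel E)"
    using lpa_eq_terms by (auto simp: refl_on_def lpa_rel_def intro: lpa_eq.refl)
  show "sym (lpa_rel E)"
    by (auto simp: sym_def lpa_rel_def intro: lpa_eq.sym)
  show "trans (lpa_rel E)"
    by (auto simp: trans_def lpa_rel_def intro: lpa_eq.trans)
qed

lemma lpa_class_eq: "lpa_eq E a b \<Longrightarrow> lpa_class E a = lpa_class E b"
  unfolding lpa_class_def using equiv_class_eq[OF equiv_lpa_rel] by (auto simp: lpa_rel_def)

lemma lpa_class_in_lpa: "a \<in> lpa_terms E \<Longrightarrow> lpa_class E a \<in> lpa E"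
  unfolding lpa_class_def lpa_def by (rule quotientI)

lemma lpa_plus_class:
  assumes "a \<in> lpa_terms E" "b \<in> lpa_terms E"
  shows "lpa_plus E (lpa_class E a) (lpa_class E b) = lpa_class E (Plus a b)"
proof -
  have "lpa_class E (Plus a' b') = lpa_class E (Plus a b)"
    if "a' \<in> lpa_class E a" "b' \<in> lpa_class E b" for a' b'
    using that by (intro lpa_class_eq lpa_eq.Plus_cong) (auto simp: lpa_class_def lpa_rel_def intro: lpa_eq.sym)
  moreover have "a \<in> lpa_class E a" "b \<in> lpa_class E b"
    using assms by (auto simp: lpa_class_def lpa_rel_def intro: lpa_eq.refl)
  ultimately show ?thesis unfolding lpa_plus_def by blast
qed

lemma lpa_scale_class:
  assumes "a \<in> lpa_terms E"
  shows "lpa_scale E k (lpa_class E a) = lpa_class E (Scale k a)"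
proof -
  have "lpa_class E (Scale k a') = lpa_class E (Scale k a)" if "a' \<in> lpa_class E a" for a'
    using that by (intro lpa_class_eq lpa_eq.Scale_cong) (auto simp: lpa_class_def lpa_rel_def intro: lpa_eq.sym)
  moreover have "a \<in> lpa_class E a"
    using assms by (auto simp: lpa_class_def lpa_rel_def intro: lpa_eq.refl)
  ultimately show ?thesis unfolding lpa_scale_def by blast
qed

lemma lpa_times_class:
  assumes "a \<in> lpa_terms E" "b \<in> lpa_terms E"
  shows "lpa_times E (lpa_class E a) (lpa_class E b) = lpa_class E (Times a b)"
proof -
  have "lpa_class E (Times a' b') = lpa_class E (Times a b)"
    if "a' \<in> lpa_class E a" "b' \<in> lpa_class E b" for a' b'
    using that by (intro lpa_class_eq lpa_eq.Times_cong) (auto simp: lpa_class_def lpa_rel_def intro: lpa_eq.sym)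
  moreover have "a \<in> lpa_class E a" "b \<in> lpa_class E b"
    using assms by (auto simp: lpa_class_def lpa_rel_def intro: lpa_eq.refl)
  ultimately show ?thesis unfolding lpa_times_def by blast
qed

text \<open>The universal property, for an arbitrary $K$-algebra on a type \<^typ>\<open>'a\<close>.\<close>

primrec lpa_eval ::
  "('k \<Rightarrow> 'a::ring \<Rightarrow> 'a) \<Rightarrow> ('v \<Rightarrow> 'a) \<Rightarrow> ('e \<Rightarrow> 'a) \<Rightarrow> ('e \<Rightarrow> 'a) \<Rightarrow> ('k, 'v, 'e) lpa_term \<Rightarrow> 'a" where
  "lpa_eval sc P S T (Vertex v) = P v"
| "lpa_eval sc P S T (Edge e) = S e"
| "lpa_eval sc P S T (Ghost e) = T e"
| "lpa_eval sc P S T Zero = 0"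
| "lpa_eval sc P S T (Plus a b) = lpa_eval sc P S T a + lpa_eval sc P S T b"
| "lpa_eval sc P S T (Scale k a) = sc k (lpa_eval sc P S T a)"
| "lpa_eval sc P S T (Times a b) = lpa_eval sc P S T a * lpa_eval sc P S T b"

lemma lpa_eval_foldr:
  "distinct es \<Longrightarrow> lpa_eval sc P S T (foldr (\<lambda>e. Plus (Times (Edge e) (Ghost e))) es Zero)
     = (\<Sum>e\<in>set es. S e * T e)"
  by (induction es) auto

theorem lpa_universal:
  fixes sc :: "'k::field \<Rightarrow> 'a::ring \<Rightarrow> 'a" and E :: "('v, 'e) pre_digraph"
  assumes "vector_space sc"
    and sc_left: "\<And>k a b. sc k a * b = sc k (a * b)"
    and sc_right: "\<And>k a b. a * sc k b = sc k (a * b)"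
    and PP: "\<And>v w. v \<in> verts E \<Longrightarrow> w \<in> verts E \<Longrightarrow> P v * P w = (if v = w then P v else 0)"
    and PS: "\<And>e. e \<in> arcs E \<Longrightarrow> P (tail E e) * S e = S e \<and> S e * P (head E e) = S e"
    and PT: "\<And>e. e \<in> arcs E \<Longrightarrow> P (head E e) * T e = T e \<and> T e * P (tail E e) = T e"
    and TS: "\<And>e f. e \<in> arcs E \<Longrightarrow> f \<in> arcs E \<Longrightarrow> T e * S f = (if e = f then P (head E e) else 0)"
    and PST: "\<And>v. v \<in> verts E \<Longrightarrow> finite (out_arcs E v) \<Longrightarrow> out_arcs E v \<noteq> {} \<Longrightarrow>
                P v = (\<Sum>e\<in>out_arcs E v. S e * T e)"
  shows "\<exists>!h. h \<in> extensional (lpa E) \<and>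
     (\<forall>a\<in>lpa E. \<forall>b\<in>lpa E. h (lpa_plus E a b) = h a + h b \<and> h (lpa_times E a b) = h a * h b) \<and>
     (\<forall>k. \<forall>a\<in>lpa E. h (lpa_scale E k a) = sc k (h a)) \<and>
     (\<forall>v\<in>verts E. h (lpa_vertex E v) = P v) \<and>
     (\<forall>e\<in>arcs E. h (lpa_edge E e) = S e \<and> h (lpa_ghost E e) = T e)"
    (is "\<exists>!h. ?hom h")
proof -
  interpret vector_space sc by fact
  let ?ev = "lpa_eval sc P S T"
  have ev: "?ev a = ?ev b" if "lpa_eq E a b" for a b
    using that
  proof induction
    case (Plus_uminus a)
    then show ?case by (simp add: scale_minus_left)
  next
    case (Vertex_sum v es)
    then have "finite (out_arcs E v)" "out_arcs E v \<noteq> {}"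
      by (metis List.finite_set) (use Vertex_sum in auto)
    with Vertex_sum show ?case
      by (simp add: lpa_eval_foldr PST)
  qed (auto simp: PP PS PT TS sc_left sc_right algebra_simps scale_right_distrib scale_left_distrib)
  define h where "h = restrict (\<lambda>A. ?ev (SOME a. a \<in> A)) (lpa E)"
  have h_class: "h (lpa_class E a) = ?ev a" if "a \<in> lpa_terms E" for a
  proof -
    have "a \<in> lpa_class E a"
      using that by (auto simp: lpa_class_def lpa_rel_def intro: lpa_eq.refl)
    then have "(SOME b. b \<in> lpa_class E a) \<in> lpa_class E a"
      by (metis someI)
    then have "?ev a = ?ev (SOME b. b \<in> lpa_class E a)"
      by (intro ev) (simp add: lpa_class_def lpa_rel_def)
    then show ?thesis
      using that by (simp add: h_def lpa_class_in_lpa)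
  qed
  have rep: "\<exists>a\<in>lpa_terms E. A = lpa_class E a" if "A \<in> lpa E"
    for A :: "('k, 'v, 'e) lpa_term set"
    using that by (auto simp: lpa_def lpa_class_def elim!: quotientE)
  show ?thesis
  proof (rule ex1I)
    show "?hom h"
    proof (intro conjI ballI allI)
      show "h \<in> extensional (lpa E)" by (simp add: h_def)
    next
      fix A B :: "('k, 'v, 'e) lpa_term set" assume "A \<in> lpa E" "B \<in> lpa E"
      with rep obtain a b where "a \<in> lpa_terms E" "b \<in> lpa_terms E"
        "A = lpa_class E a" "B = lpa_class E b" by meson
      then show "h (lpa_plus E A B) = h A + h B" "h (lpa_times E A B) = h A * h B"
        by (simp_all add: lpa_plus_class lpa_times_class h_class lpa_terms.intros)
    next
      fix k and A :: "('k, 'v, 'e) lpa_term set" assume "A \<in> lpa E"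
      with rep obtain a where "a \<in> lpa_terms E" "A = lpa_class E a" by meson
      then show "h (lpa_scale E k A) = sc k (h A)"
        by (simp add: lpa_scale_class h_class lpa_terms.intros)
    qed (simp_all add: h_class lpa_terms.intros)
  next
    fix g assume g: "?hom g"
    have g_class: "g (lpa_class E a) = ?ev a" if "a \<in> lpa_terms E" for a
      using that
    proof induction
      case Zero
      have "lpa_scale E 0 (lpa_class E Zero) = lpa_class E (Scale (0::'k) Zero)"
        by (simp add: lpa_scale_class lpa_terms.intros)
      moreover have "lpa_plus E (lpa_class E Zero) (lpa_class E Zero)
          = (lpa_class E Zero :: ('k, 'v, 'e) lpa_term set)"
        by (simp add: lpa_plus_class lpa_terms.intros lpa_class_eq lpa_eq.Plus_Zero)
      then have "g (lpa_class E Zero) = g (lpa_class E Zero) + g (lpa_class E Zero)"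
        using g by (metis lpa_class_in_lpa lpa_terms.Zero)
      then show ?case by simp
    next
      case (Plus a b)
      then show ?case using g by (metis lpa_class_in_lpa lpa_plus_class lpa_eval.simps(5))
    next
      case (Scale a k)
      then show ?case using g by (metis lpa_class_in_lpa lpa_scale_class lpa_eval.simps(6))
    next
      case (Times a b)
      then show ?case using g by (metis lpa_class_in_lpa lpa_times_class lpa_eval.simps(7))
    qed (use g in simp_all)
    show "g = h"
    proof (rule extensionalityI)
      show "g \<in> extensional (lpa E)" using g by blast
      show "h \<in> extensional (lpa E)" by (simp add: h_def)
      show "g A = h A" if "A \<in> lpa E" for A
        using rep[OF that] g_class h_class by auto
    qed
  qed
qed

lemma vector_space_finsupp_scale:
  "vector_space (finsupp_scale :: 'k::field \<Rightarrow> ('x \<Rightarrow>\<^sub>0 'k) \<Rightarrow> _)"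
  and subspace_finsupp_module:
  "module.subspace finsupp_scale (finsupp_module X :: ('x \<Rightarrow>\<^sub>0 'k::field) set)"
proof -
  have lk: "Poly_Mapping.lookup (finsupp_scale k \<phi>) x = k * Poly_Mapping.lookup \<phi> x" for k :: 'k and \<phi> and x :: 'x
    by (simp add: finsupp_scale_def map.rep_eq when_def)
  show vs: "vector_space (finsupp_scale :: 'k::field \<Rightarrow> ('x \<Rightarrow>\<^sub>0 'k) \<Rightarrow> _)"
    by unfold_locales (auto intro!: poly_mapping_eqI simp: lk lookup_add algebra_simps)
  have md: "module (finsupp_scale :: 'k::field \<Rightarrow> ('x \<Rightarrow>\<^sub>0 'k) \<Rightarrow> _)"
    using vs by (simp add: vector_space_def module_def)
  show "module.subspace finsupp_scale (finsupp_module X :: ('x \<Rightarrow>\<^sub>0 'k) set)"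
    unfolding module.subspace_def[OF md] finsupp_module_def
    by (auto simp: in_keys_iff lk lookup_add subset_iff)
      (metis add_0)
qed

lemma lpa_rep_Zero:
  fixes sc :: "'k::field \<Rightarrow> 'a::ab_group_add \<Rightarrow> 'a"
  assumes "lpa_rep E sc M \<Phi>" "x \<in> M"
  shows "\<Phi> (lpa_class E Zero) x = 0"
proof -
  have "lpa_plus E (lpa_class E Zero) (lpa_class E Zero) = (lpa_class E Zero :: ('k, _, _) lpa_term set)"
    by (simp add: lpa_plus_class lpa_terms.intros lpa_class_eq lpa_eq.Plus_Zero)
  then have "\<Phi> (lpa_class E Zero) x = \<Phi> (lpa_class E Zero) x + \<Phi> (lpa_class E Zero) x"
    using assms unfolding lpa_rep_def by (metis lpa_class_in_lpa lpa_terms.Zero)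
  then show ?thesis by simp
qed

lemma lpa_rep_Times:
  assumes "lpa_rep E sc UNIV \<Phi>" "a \<in> lpa_terms E" "b \<in> lpa_terms E"
  shows "\<Phi> (lpa_class E a) (\<Phi> (lpa_class E b) x) = \<Phi> (lpa_class E (Times a b)) x"
  using assms unfolding lpa_rep_def
  by (metis UNIV_I lpa_class_in_lpa lpa_times_class)

lemma independent_familyI:
  fixes p :: "'i \<Rightarrow> 'a::ab_group_add \<Rightarrow> 'a"
  assumes add: "\<And>i x y. i \<in> I \<Longrightarrow> p i (x + y) = p i x + p i y"
    and same: "\<And>i x. i \<in> I \<Longrightarrow> x \<in> A i \<Longrightarrow> p i x = x"
    and diff: "\<And>i j x. i \<in> I \<Longrightarrow> j \<in> I \<Longrightarrow> i \<noteq> j \<Longrightarrow> x \<in> A j \<Longrightarrow> p i x = 0"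
  shows "independent_family I A"
  unfolding independent_family_def
proof (intro allI impI ballI, elim conjE)
  fix J x j
  assume J: "finite J" "J \<subseteq> I" "\<forall>j\<in>J. x j \<in> A j" "(\<Sum>j\<in>J. x j) = 0" and j: "j \<in> J"
  have ji: "j \<in> I" using J j by auto
  interpret p: Modules.additive "p j" by unfold_locales (simp add: add ji)
  have "0 = (\<Sum>i\<in>J. p j (x i))" using J(4) by (metis p.sum p.zero)
  also have "\<dots> = (\<Sum>i\<in>J. if i = j then x j else 0)"
    using J by (intro sum.cong) (auto simp: subset_iff intro: same[OF ji] diff[OF ji])
  also have "\<dots> = x j" using J(1) j by simp
  finally show "x j = 0" by simp
qed

lemma independent_vertex_spaces:
  assumes "lpa_rep E sc UNIV \<Phi>"
  shows "independent_family (verts E) (vertex_space E \<Phi>)"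
proof (rule independent_familyI[where p = "\<lambda>v. \<Phi> (lpa_vertex E v)"])
  show "\<Phi> (lpa_vertex E v) (x + y) = \<Phi> (lpa_vertex E v) x + \<Phi> (lpa_vertex E v) y"
    if "v \<in> verts E" for v x y
    using assms that by (simp add: lpa_rep_def linear_map_on_def lpa_class_in_lpa lpa_terms.intros)
  show "\<Phi> (lpa_vertex E v) x = x" if "v \<in> verts E" "x \<in> vertex_space E \<Phi> v" for v x
    using that by (auto simp: vertex_space_def lpa_rep_Times[OF assms] lpa_terms.intros
        lpa_class_eq[OF lpa_eq.Vertex_idem])
  show "\<Phi> (lpa_vertex E v) x = 0"
    if "v \<in> verts E" "w \<in> verts E" "v \<noteq> w" "x \<in> vertex_space E \<Phi> w" for v w x
    using that by (auto simp: vertex_space_def lpa_rep_Times[OF assms] lpa_terms.intros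
        lpa_class_eq[OF lpa_eq.Vertex_orthogonal] lpa_rep_Zero[OF assms])
qed

lemma independent_edge_spaces:
  assumes "wf_digraph E" and rep: "lpa_rep E sc UNIV \<Phi>"
  shows "independent_family (arcs E) (edge_space E \<Phi>)"
proof (rule independent_familyI[where p = "\<lambda>e x. \<Phi> (lpa_edge E e) (\<Phi> (lpa_ghost E e) x)"])
  interpret wf_digraph E by fact
  have add: "\<Phi> (lpa_class E a) (x + y) = \<Phi> (lpa_class E a) x + \<Phi> (lpa_class E a) y"
    if "a \<in> lpa_terms E" for a x y
    using rep that by (simp add: lpa_rep_def linear_map_on_def lpa_class_in_lpa)
  show "\<Phi> (lpa_edge E e) (\<Phi> (lpa_ghost E e) (x + y)) =
      \<Phi> (lpa_edge E e) (\<Phi> (lpa_ghost E e) x) + \<Phi> (lpa_edge E e) (\<Phi> (lpa_ghost E e) y)"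
    if "e \<in> arcs E" for e x y
    using that by (simp add: add lpa_terms.intros)
  have zero: "\<Phi> (lpa_class E a) 0 = 0" if "a \<in> lpa_terms E" for a
    using add[OF that, of 0 0] by simp
  show "\<Phi> (lpa_edge E e) (\<Phi> (lpa_ghost E e) x) = x"
    if "e \<in> arcs E" "x \<in> edge_space E \<Phi> e" for e x
  proof -
    from that(2) obtain y where "x = \<Phi> (lpa_edge E e) (\<Phi> (lpa_ghost E e) y)"
      by (auto simp: edge_space_def)
    moreover have "\<Phi> (lpa_ghost E e) (\<Phi> (lpa_edge E e) z) = \<Phi> (lpa_vertex E (head E e)) z" for z
      using that(1) lpa_rep_Times[OF rep, of "Ghost e" "Edge e"]
      by (simp add: lpa_terms.intros lpa_class_eq[OF lpa_eq.Ghost_Edge_same])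
    moreover have "\<Phi> (lpa_vertex E (head E e)) (\<Phi> (lpa_ghost E e) y) = \<Phi> (lpa_ghost E e) y"
      using that(1) lpa_rep_Times[OF rep, of "Vertex (head E e)" "Ghost e"]
      by (simp add: lpa_terms.intros lpa_class_eq[OF lpa_eq.head_Ghost])
    ultimately show ?thesis by simp
  qed
  show "\<Phi> (lpa_edge E e) (\<Phi> (lpa_ghost E e) x) = 0"
    if "e \<in> arcs E" "f \<in> arcs E" "e \<noteq> f" "x \<in> edge_space E \<Phi> f" for e f x
    using that
    by (auto simp: edge_space_def lpa_rep_Times[OF rep, of "Ghost e" "Edge f"] lpa_terms.intros
        lpa_class_eq[OF lpa_eq.Ghost_Edge_diff] lpa_rep_Zero[OF rep] zero)
qed

text \<open>
  The exceptional vertex left over by the level construction may carry a loop, and then not every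
  representation comes from a branching system: $L_K(E)$ of a single loop is $K[t, t^{-1}]$, and
  $t$ may act on the line $K = \mathbb{Q}$ as multiplication by $2$. This is why the loops are excluded in the
  theorem.
\<close>

lemma loop_counterexample:
  fixes E :: "(unit, unit) pre_digraph"
  assumes E: "E = \<lparr>verts = {()}, arcs = {()}, tail = (\<lambda>_. ()), head = (\<lambda>_. ())\<rparr>"
  shows "is_component E {()} \<and> isolated_verts E = {} \<and> level_verts (component_graph E {()}) n = {} \<and>
    (\<exists>\<Phi> :: (rat, unit, unit) lpa_term set \<Rightarrow> rat \<Rightarrow> rat.
       lpa_rep E (*) UNIV \<Phi> \<and> rep_support E (*) \<Phi> = UNIV \<and>
       \<not> (\<exists>(X :: 'x set) R D f \<pi>.
            algebraic_branching_system E X R D f \<and> is_induced_rep E X R D f \<pi> \<and>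
            equivalent_reps E finsupp_scale (finsupp_module X) \<pi> (*) UNIV \<Phi>))"
proof (intro conjI)
  have "unoriented_path E () [()] [] ()"
    by (simp add: unoriented_path_def E)
  then show "is_component E {()}"
    by (auto simp: is_component_def isolated_verts_def unoriented_connected_def in_arcs_def out_arcs_def E)
  show "isolated_verts E = {}"
    by (auto simp: isolated_verts_def in_arcs_def E)
  have "component_graph E {()} = E" by (auto simp: component_graph_def E)
  moreover have "extreme_verts E = {}" by (auto simp: extreme_verts_def E)
  moreover from this have "remove_extreme E = E" by (simp add: remove_extreme_def extreme_arcs_def E)
  then have "(remove_extreme ^^ k) E = E" for k by (induction k) simp_all
  ultimately show "level_verts (component_graph E {()}) n = {}"
    by (simp add: level_verts_def)
  interpret Q: vector_space "(*) :: rat \<Rightarrow> rat \<Rightarrow> rat"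
    by unfold_locales (simp_all add: algebra_simps)
  have g: "verts E = {()}" "arcs E = {()}" "tail E e = ()" "head E e = ()" for e by (simp_all add: E)
  have o: "out_arcs E v = {()}" for v by (auto simp: out_arcs_def E)
  obtain h :: "(rat, unit, unit) lpa_term set \<Rightarrow> rat" where
    h: "\<forall>a\<in>lpa E. \<forall>b\<in>lpa E. h (lpa_plus E a b) = h a + h b \<and> h (lpa_times E a b) = h a * h b"
       "\<forall>k. \<forall>a\<in>lpa E. h (lpa_scale E k a) = k * h a"
       "h (lpa_vertex E ()) = 1" "h (lpa_edge E ()) = 2" "h (lpa_ghost E ()) = 1 / 2"
  proof -
    have "\<exists>!h :: (rat, unit, unit) lpa_term set \<Rightarrow> rat. h \<in> extensional (lpa E) \<and>
       (\<forall>a\<in>lpa E. \<forall>b\<in>lpa E. h (lpa_plus E a b) = h a + h b \<and> h (lpa_times E a b) = h a * h b) \<and>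
       (\<forall>k. \<forall>a\<in>lpa E. h (lpa_scale E k a) = k * h a) \<and>
       (\<forall>v\<in>verts E. h (lpa_vertex E v) = 1) \<and>
       (\<forall>e\<in>arcs E. h (lpa_edge E e) = 2 \<and> h (lpa_ghost E e) = 1 / 2)"
      by (rule lpa_universal[OF Q.vector_space_axioms]) (simp_all add: o)
    from ex1_implies_ex[OF this] obtain h :: "(rat, unit, unit) lpa_term set \<Rightarrow> rat" where h:
      "\<forall>a\<in>lpa E. \<forall>b\<in>lpa E. h (lpa_plus E a b) = h a + h b \<and> h (lpa_times E a b) = h a * h b"
      "\<forall>k. \<forall>a\<in>lpa E. h (lpa_scale E k a) = k * h a"
      "\<forall>v\<in>verts E. h (lpa_vertex E v) = 1"
      "\<forall>e\<in>arcs E. h (lpa_edge E e) = 2 \<and> h (lpa_ghost E e) = 1 / 2"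
      by (elim exE conjE)
    have "h (lpa_vertex E ()) = 1" "h (lpa_edge E ()) = 2" "h (lpa_ghost E ()) = 1 / 2"
      using h(3,4) unfolding g by blast+
    with h(1,2) show thesis by (rule that)
  qed
  show "\<exists>\<Phi> :: (rat, unit, unit) lpa_term set \<Rightarrow> rat \<Rightarrow> rat.
       lpa_rep E (*) UNIV \<Phi> \<and> rep_support E (*) \<Phi> = UNIV \<and>
       \<not> (\<exists>(X :: 'x set) R D f \<pi>.
            algebraic_branching_system E X R D f \<and> is_induced_rep E X R D f \<pi> \<and>
            equivalent_reps E finsupp_scale (finsupp_module X) \<pi> (*) UNIV \<Phi>)"
  proof (rule exI[of _ "\<lambda>a x. h a * x"], intro conjI notI)
    let ?\<Phi> = "\<lambda>a x. h a * x"
    show "lpa_rep E (*) UNIV ?\<Phi>"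
      unfolding lpa_rep_def linear_map_on_def
    proof (intro conjI ballI allI)
      fix a b :: "(rat, unit, unit) lpa_term set" and x :: rat assume "a \<in> lpa E" "b \<in> lpa E"
      then show "h (lpa_plus E a b) * x = h a * x + h b * x" "h (lpa_times E a b) * x = h a * (h b * x)"
        using h(1) by (simp_all add: distrib_right)
    next
      fix a :: "(rat, unit, unit) lpa_term set" and k x :: rat assume "a \<in> lpa E"
      then show "h (lpa_scale E k a) * x = k * (h a * x)" using h(2) by simp
    qed (simp_all add: distrib_left)
    have "vertex_space E ?\<Phi> () = UNIV"
      by (simp add: vertex_space_def h)
    then show "rep_support E (*) ?\<Phi> = UNIV"
      by (simp add: rep_support_def subspace_sum_def g)
  next
    assume "\<exists>(X :: 'x set) R D f \<pi>.
            algebraic_branching_system E X R D f \<and> is_induced_rep E X R D f \<pi> \<and>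
            equivalent_reps E finsupp_scale (finsupp_module X) \<pi> (*) UNIV (\<lambda>a x. h a * x)"
    then obtain X :: "'x set" and R D f \<pi> U where
      b: "algebraic_branching_system E X R D f" and i: "is_induced_rep E X R D f \<pi>" and
      U: "linear_map_on (*) UNIV finsupp_scale (finsupp_module X) U" "bij_betw U UNIV (finsupp_module X)"
        "\<forall>a\<in>lpa E. \<forall>x. U (h a * x) = \<pi> a (U x)"
      by (auto simp: equivalent_reps_def)
    have lk: "Poly_Mapping.lookup (finsupp_scale k \<phi>) x = k * Poly_Mapping.lookup \<phi> x"
      for k :: rat and \<phi> and x :: 'x
      by (simp add: finsupp_scale_def map.rep_eq when_def)
    define \<phi> where "\<phi> = U 1"
    have \<phi>M: "\<phi> \<in> finsupp_module X" using U(2) by (auto simp: \<phi>_def bij_betw_def)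
    have Us: "U k = finsupp_scale k \<phi>" for k
      using U(1) by (metis UNIV_I \<phi>_def linear_map_on_def mult.right_neutral)
    have line: "\<exists>c. Poly_Mapping.single x 1 = finsupp_scale c \<phi>" if "x \<in> X" for x
    proof -
      have "Poly_Mapping.single x 1 \<in> finsupp_module X" using that by (simp add: finsupp_module_def)
      with U(2) show ?thesis by (metis Us bij_betw_imp_surj_on imageE)
    qed
    have "U 1 \<noteq> U 0" using U(2) by (metis UNIV_I bij_betw_iff_bijections zero_neq_one)
    then have "\<phi> \<noteq> 0" unfolding Us
      by (metis lk lookup_zero mult_zero_right poly_mapping_eqI)
    then obtain x where x: "Poly_Mapping.lookup \<phi> x \<noteq> 0"
      by (metis lookup_zero poly_mapping_eqI)
    have xX: "x \<in> X" using x \<phi>M by (auto simp: finsupp_module_def in_keys_iff)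
    have X: "X = {x}"
    proof -
      have "y = x" if "y \<in> X" for y
      proof (rule ccontr)
        assume "y \<noteq> x"
        obtain c where c: "Poly_Mapping.single y 1 = finsupp_scale c \<phi>" using line[OF \<open>y \<in> X\<close>] by auto
        have "c * Poly_Mapping.lookup \<phi> x = 0" "c * Poly_Mapping.lookup \<phi> y = 1"
          using \<open>y \<noteq> x\<close> by (simp_all flip: lk c add: lookup_single when_def)
        then show False using x by auto
      qed
      with xX show ?thesis by blast
    qed
    have l: "lpa_vertex E () \<in> (lpa E :: (rat, unit, unit) lpa_term set set)"
      "lpa_edge E () \<in> (lpa E :: (rat, unit, unit) lpa_term set set)"
      by (auto intro!: lpa_class_in_lpa lpa_terms.intros simp: g)
    have \<pi>: "\<pi> (lpa_vertex E ()) \<phi> = \<phi>" "\<pi> (lpa_edge E ()) \<phi> = finsupp_scale 2 \<phi>"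
      using U(3)[rule_format, OF l(1), of 1] U(3)[rule_format, OF l(2), of 1] h(3,4) Us[of 2]
      by (simp_all add: \<phi>_def)
    have "Poly_Mapping.lookup (\<pi> (lpa_vertex E ()) \<phi>) x = (if x \<in> D () then Poly_Mapping.lookup \<phi> x else 0)"
      using i \<phi>M xX by (simp add: is_induced_rep_def g)
    then have xD: "x \<in> D ()" using x \<pi> by (auto split: if_splits)
    moreover have "D () = R ()" "D () \<subseteq> X" "bij_betw (f ()) (D ()) (R ())"
      using b o[of "()"] by (auto simp: algebraic_branching_system_def g)
    ultimately have D: "D () = {x}" "R () = {x}" "f () x = x"
      using X by (auto simp: bij_betw_def)
    have "the_inv_into {x} (f ()) x = x"
      using the_inv_into_f_f[of "f ()" "{x}" x] D by simp
    moreover have "Poly_Mapping.lookup (\<pi> (lpa_edge E ()) \<phi>) x =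
       (if x \<in> R () then Poly_Mapping.lookup \<phi> (the_inv_into (D ()) (f ()) x) else 0)"
      using i \<phi>M xX by (simp add: is_induced_rep_def g)
    ultimately show False using x by (simp add: \<pi> D lk)
  qed
qed

end

theory Submission
  imports Defs
begin

text \<open>
  Without loops, a one-sided infinite directed walk loses at most its first vertex each time the
  extreme vertices and arcs are removed, so finitely many levels rule such walks out: the relation
  between the range and the source of an arc is well-founded. Along it one defines bases $B_u$ of
  the spaces $V_u$ with $B_u = C_u \cup \bigcup_{s(e) = u} \Phi(e)(B_{r(e)})$, where $C_u$ is a basis
  of a complement of $\bigoplus_{s(e) = u} V_e$ in $V_u$ on which all $\Phi(e^*)$ vanish. The
  generators of $L_K(E)$ then send basis vectors to basis vectors or to $0$, and $D_u = B_u$,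
  $R_e = \Phi(e)(B_{r(e)})$, $f_e = \Phi(e)$ is the required branching system; taking coordinates is
  the equivalence.
\<close>

section \<open>Unoriented paths and connected components\<close>

lemma unoriented_path_refl: "v \<in> verts E \<Longrightarrow> unoriented_path E v [v] [] v"
  by (simp add: unoriented_path_def)

lemma unoriented_path_rev:
  assumes "unoriented_path E u us es v"
  shows "unoriented_path E v (rev us) (rev es) u"
proof -
  have len: "length us = Suc (length es)" and ne: "us \<noteq> []"
    using assms by (auto simp: unoriented_path_def)
  have step: "(tail E (es ! i) = us ! i \<and> head E (es ! i) = us ! Suc i) \<or>
      (head E (es ! i) = us ! i \<and> tail E (es ! i) = us ! Suc i)" if "i < length es" for i
    using assms that by (auto simp: unoriented_path_def)
  have "(tail E (rev es ! i) = rev us ! i \<and> head E (rev es ! i) = rev us ! Suc i) \<or>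
      (head E (rev es ! i) = rev us ! i \<and> tail E (rev es ! i) = rev us ! Suc i)"
    if i: "i < length es" for i
  proof -
    \<comment> \<open>Arc \<open>i\<close> of the reversed path is arc
      \<open>length es - Suc i\<close> of the original one; the end of that arc at its later
      position is entry \<open>i\<close> of \<open>rev us\<close>.\<close>
    have "Suc (length es - Suc i) = length es - i" using i by simp
    then show ?thesis
      using step[of "length es - Suc i"] i len by (auto simp: rev_nth)
  qed
  then show ?thesis
    using assms ne by (auto simp: unoriented_path_def hd_rev last_rev)
qed

lemma unoriented_path_prefix:
  assumes "unoriented_path E u us es v" "j < length us"
  shows "unoriented_path E u (take (Suc j) us) (take j es) (us ! j)"
proof -
  have "take (Suc j) us \<noteq> []" "length us = Suc (length es)"
    using assms by (auto simp: unoriented_path_def)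
  moreover from this assms(2) have "last (take (Suc j) us) = us ! j"
    by (simp add: last_conv_nth)
  ultimately show ?thesis
    using assms set_take_subset[of "Suc j" us] set_take_subset[of j es]
    by (auto simp: unoriented_path_def)
qed

text \<open>Appending \<open>e\<close> keeps the arcs distinct only if \<open>e\<close> is not on
  the path yet. If it is, both its ends are on the path, among them \<open>w\<close>, and a prefix
  ending at \<open>w\<close> will do.\<close>

lemma unoriented_path_step:
  assumes p: "unoriented_path E u us es v" and e: "e \<in> arcs E" and w: "w \<in> verts E"
    and vw: "(tail E e = v \<and> head E e = w) \<or> (head E e = v \<and> tail E e = w)"
  shows "\<exists>us es. unoriented_path E u us es w"
proof (cases "e \<in> set es")
  case True
  then obtain i where i: "i < length es" "es ! i = e" by (auto simp: in_set_conv_nth)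
  then have "(tail E e = us ! i \<and> head E e = us ! Suc i) \<or>
      (head E e = us ! i \<and> tail E e = us ! Suc i)" and len: "length us = Suc (length es)"
    using p by (auto simp: unoriented_path_def)
  then have "w = us ! i \<or> w = us ! Suc i" using vw by auto
  then obtain j where "j < length us" "w = us ! j" using i len by (metis Suc_less_eq less_SucI)
  then show ?thesis using unoriented_path_prefix[OF p] by blast
next
  case False
  have "us \<noteq> []" "length us = Suc (length es)" "last us = v" using p by (auto simp: unoriented_path_def)
  then have "us ! length es = v" by (simp add: last_conv_nth)
  then have "unoriented_path E u (us @ [w]) (es @ [e]) w"
    using p False e w vw \<open>us \<noteq> []\<close> by (auto simp: unoriented_path_def nth_append less_Suc_eq)
  then show ?thesis by blast
qed

text \<open>By maximality: \<open>Z\<close> together with the head of \<open>e\<close> is still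
  connected, because every path to the tail extends along \<open>e\<close>, and it contains no
  isolated vertex.\<close>

lemma is_component_closed:
  assumes "wf_digraph E" "is_component E Z" "e \<in> arcs E" "tail E e \<in> Z"
  shows "head E e \<in> Z"
proof -
  interpret wf_digraph E by fact
  let ?w = "head E e"
  have c: "unoriented_connected E Z" and Z: "Z \<subseteq> verts E - isolated_verts E"
    and max: "\<And>Z'. Z \<subseteq> Z' \<Longrightarrow> Z' \<subseteq> verts E - isolated_verts E \<Longrightarrow> unoriented_connected E Z' \<Longrightarrow> Z' = Z"
    using assms(2) by (auto simp: is_component_def)
  have to: "\<exists>us es. unoriented_path E x us es ?w" if "x \<in> Z" for x
  proof -
    obtain us es where "unoriented_path E x us es (tail E e)"
      using c \<open>x \<in> Z\<close> assms(4) unfolding unoriented_connected_def by blast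
    then show ?thesis by (rule unoriented_path_step) (use assms(3) in auto)
  qed
  then have "\<exists>us es. unoriented_path E ?w us es x" if "x \<in> Z" for x
    using unoriented_path_rev that by metis
  moreover have "\<exists>us es. unoriented_path E ?w us es ?w"
    using unoriented_path_refl[of ?w E] assms(3) head_in_verts by blast
  moreover have "insert ?w Z \<subseteq> verts E" using Z assms(3) by auto
  ultimately have "unoriented_connected E (insert ?w Z)"
    using to c unfolding unoriented_connected_def by (metis insert_iff)
  moreover have "insert ?w Z \<subseteq> verts E - isolated_verts E"
    using Z assms(3) by (auto simp: isolated_verts_def in_arcs_def)
  ultimately show ?thesis using max[of "insert ?w Z"] by blast
qed

section \<open>Levels and one-sided infinite walks\<close>

lemma funpow_remove_extreme [simp]:
  "tail ((remove_extreme ^^ n) F) = tail F"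
  "head ((remove_extreme ^^ n) F) = head F"
  by (induction n) (simp_all add: remove_extreme_def)

lemma verts_funpow_remove_extreme:
  "verts ((remove_extreme ^^ n) F) = verts F - (\<Union>k\<in>{1..n}. level_verts F k)"
proof (induction n)
  case (Suc n)
  \<comment> \<open>Levels are counted from 1, so level \<open>Suc n\<close> consists of the extreme
    vertices of the graph left after \<open>n\<close> removals.\<close>
  have "verts ((remove_extreme ^^ Suc n) F) = verts ((remove_extreme ^^ n) F) - level_verts F (Suc n)"
    by (simp add: remove_extreme_def level_verts_def)
  with Suc show ?case by (auto simp: atLeastAtMostSuc_conv)
qed simp

text \<open>Every inner vertex of a directed walk meets two distinct arcs of it, so passing to the next
  level shortens a one-sided infinite walk by at most its first vertex.\<close>

lemma walk_survives:
  assumes arcs: "\<And>i. e i \<in> arcs F"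
    and verts: "\<And>i. tail F (e i) \<in> verts F"
    and walk: "\<And>i. head F (e i) = tail F (e (Suc i))"
    and no_loops: "\<And>i. tail F (e i) \<noteq> head F (e i)"
    and "n \<le> i"
  shows "e i \<in> arcs ((remove_extreme ^^ n) F) \<and> tail F (e i) \<in> verts ((remove_extreme ^^ n) F)"
  using \<open>n \<le> i\<close>
proof (induction n arbitrary: i)
  case 0
  then show ?case by (simp add: arcs verts)
next
  case (Suc n)
  let ?G = "(remove_extreme ^^ n) F"
  have not_extreme: "tail F (e j) \<notin> extreme_verts ?G" if "Suc n \<le> j" for j
  proof
    assume "tail F (e j) \<in> extreme_verts ?G"
    then have "card (in_arcs ?G (tail F (e j)) \<union> out_arcs ?G (tail F (e j))) = 1"
      by (simp add: extreme_verts_def)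
    then obtain a where a: "in_arcs ?G (tail F (e j)) \<union> out_arcs ?G (tail F (e j)) = {a}"
      by (auto simp: card_1_singleton_iff)
    have "j \<noteq> 0" using that by simp
    \<comment> \<open>The walk reaches this vertex by \<open>e k\<close>. Since
      \<open>Suc n \<le> j\<close> gives \<open>n \<le> k\<close>, the induction hypothesis covers
      \<open>e k\<close> as well as \<open>e j\<close>; this shift by one is the vertex lost per
      level.\<close>
    then obtain k where k: "j = Suc k" using not0_implies_Suc by blast
    then have "n \<le> k" "n \<le> j" using that by simp_all
    then have "e k \<in> in_arcs ?G (tail F (e j))" "e j \<in> out_arcs ?G (tail F (e j))"
      using Suc.IH[of k] Suc.IH[of j] k walk[of k] by (simp_all add: in_arcs_def out_arcs_def)
    then have "e k = e j" using a by (metis UnI1 UnI2 singletonD)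
    then show False using walk[of k] no_loops[of j] k by simp
  qed
  \<comment> \<open>An extreme arc has an extreme end, and the ends of \<open>e i\<close> are the
    tails of \<open>e i\<close> and \<open>e (Suc i)\<close>.\<close>
  have "e i \<notin> extreme_arcs ?G"
    using not_extreme[of i] not_extreme[of "Suc i"] Suc.prems walk[of i]
    by (simp add: extreme_arcs_def in_arcs_def out_arcs_def) metis
  then show ?case
    using Suc.IH[of i] Suc.prems not_extreme[of i] by (simp add: remove_extreme_def[of ?G])
qed

text \<open>An infinite descending chain is an infinite directed walk. The number \<open>m\<close>
  of levels depends on the component, so the walk is first confined to a single one. From step
  \<open>m\<close> on its vertices survive \<open>m\<close> removals, after which at most
  \<open>w\<close> is left in the component; the walk would then run along a loop at
  \<open>w\<close>.\<close>

lemma wf_arcs_if_finite_levels: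
  assumes graph: "wf_digraph E"
    and no_loops: "\<And>e. e \<in> arcs E \<Longrightarrow> tail E e \<noteq> head E e"
    and covered: "\<And>v. v \<in> verts E - isolated_verts E \<Longrightarrow> \<exists>Z m w. v \<in> Z \<and> is_component E Z \<and>
      Z \<subseteq> insert w (\<Union>n\<in>{1..m}. level_verts (component_graph E Z) n)"
  shows "wf {(head E e, tail E e) |e. e \<in> arcs E}"
  unfolding wf_iff_no_infinite_down_chain
proof
  interpret wf_digraph E by fact
  assume "\<exists>f. \<forall>i. (f (Suc i), f i) \<in> {(head E e, tail E e) |e. e \<in> arcs E}"
  then obtain f where f: "\<forall>i. (f (Suc i), f i) \<in> {(head E e, tail E e) |e. e \<in> arcs E}" ..
  have "\<exists>e. e \<in> arcs E \<and> tail E e = f i \<and> head E e = f (Suc i)" for i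
    using f[rule_format, of i] by auto
  then obtain e where e: "\<And>i. e i \<in> arcs E" "\<And>i. tail E (e i) = f i" "\<And>i. head E (e i) = f (Suc i)"
    by metis
  have "f 0 \<in> verts E - isolated_verts E"
    using e(1,2)[of 0] tail_in_verts[of "e 0"] by (auto simp: isolated_verts_def out_arcs_def)
  then obtain Z m w where Z: "f 0 \<in> Z" "is_component E Z"
    "Z \<subseteq> insert w (\<Union>n\<in>{1..m}. level_verts (component_graph E Z) n)"
    using covered by blast
  have fZ: "f i \<in> Z" for i
  proof (induction i)
    case (Suc i)
    then show ?case using is_component_closed[OF graph Z(2) e(1)[of i]] e(2,3)[of i] by simp
  qed (fact Z(1))
  let ?F = "component_graph E Z"
  have F: "verts ?F = Z" "tail ?F = tail E" "head ?F = head E" "arcs ?F = {e \<in> arcs E. head E e \<in> Z \<or> tail E e \<in> Z}"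
    by (simp_all add: component_graph_def)
  have "f i \<in> verts ((remove_extreme ^^ m) ?F)" if "m \<le> i" for i
    using walk_survives[of e ?F m i] that e fZ no_loops[OF e(1)] by (simp add: F)
  then have "f i = w" if "m \<le> i" for i
    using Z(3) that unfolding verts_funpow_remove_extreme F by blast
  then have "f m = w" "f (Suc m) = w" by simp_all
  then show False using no_loops[OF e(1)[of m]] e by simp
qed

section \<open>Bases of direct sums and linear maps in a basis\<close>

lemma (in module) span_UN_span: "span (\<Union>i\<in>I. span (A i)) = span (\<Union>i\<in>I. A i)"
proof (rule antisym)
  have "span (A i) \<subseteq> span (\<Union>i\<in>I. A i)" if "i \<in> I" for i
    using that by (intro span_mono) blast
  then show "span (\<Union>i\<in>I. span (A i)) \<subseteq> span (\<Union>i\<in>I. A i)"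
    by (intro span_minimal) auto
  show "span (\<Union>i\<in>I. A i) \<subseteq> span (\<Union>i\<in>I. span (A i))"
    by (intro span_mono UN_mono span_superset) simp
qed

text \<open>A vanishing linear combination is grouped by summand. Each group lies in one
  \<open>A i\<close>, so independence of the family makes every group vanish separately, and then
  independence of \<open>B i\<close> applies.\<close>

lemma (in module) independent_UN:
  assumes family: "independent_family I A"
    and sub: "\<And>i. i \<in> I \<Longrightarrow> subspace (A i)"
    and B: "\<And>i. i \<in> I \<Longrightarrow> B i \<subseteq> A i" "\<And>i. i \<in> I \<Longrightarrow> independent (B i)"
  shows "independent (\<Union>i\<in>I. B i)"
  unfolding independent_explicit_module
proof (intro allI impI)
  fix t c v assume t: "finite t" "t \<subseteq> (\<Union>i\<in>I. B i)" "(\<Sum>v\<in>t. scale (c v) v) = 0" "v \<in> t"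
  then have "\<forall>v\<in>t. \<exists>i. i \<in> I \<and> v \<in> B i" by blast
  \<comment> \<open>The sets \<open>B i\<close> are not assumed disjoint; choosing one index for
    each vector makes the groups a partition of \<open>t\<close>.\<close>
  then obtain j where j: "\<And>v. v \<in> t \<Longrightarrow> j v \<in> I \<and> v \<in> B (j v)" by metis
  define x where "x i = (\<Sum>v | v \<in> t \<and> j v = i. scale (c v) v)" for i
  have "(\<Sum>i\<in>j ` t. x i) = 0"
    using t(1,3) by (simp add: x_def sum.image_gen[of t _ j])
  moreover have "\<forall>i\<in>j ` t. x i \<in> A i"
  proof
    fix i assume "i \<in> j ` t"
    then have i: "i \<in> I" using j by auto
    show "x i \<in> A i"
      unfolding x_def
    proof (rule subspace_sum[OF sub[OF i]], rule subspace_scale[OF sub[OF i]])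
      fix v assume "v \<in> {v \<in> t. j v = i}"
      then show "v \<in> A i" using j[of v] B(1)[OF i] by blast
    qed
  qed
  moreover have "finite (j ` t)" "j ` t \<subseteq> I" "j v \<in> j ` t" using j t by auto
  ultimately have "x (j v) = 0"
    using family[unfolded independent_family_def, rule_format, of "j ` t" x "j v"] by blast
  then show "c v = 0"
    using independentD[OF B(2)[of "j v"], of "{w \<in> t. j w = j v}" c v] t(1,4) j
    unfolding x_def by fastforce
qed

lemma (in vector_space) basis_of_complement:
  assumes compl: "is_complement scale A B S"
    and C: "independent C" "span C = A" and D: "independent D" "span D = B"
  shows "independent (C \<union> D)" "span (C \<union> D) = S"
proof -
  have AB: "subspace A" "subspace B" "A \<inter> B = {0}" using compl by (auto simp: is_complement_def)
  show "span (C \<union> D) = S"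
    using compl C D by (simp add: span_Un is_complement_def)
  \<comment> \<open>The two summands form a family indexed by \<open>bool\<close>, which makes
    \<open>independent_UN\<close> applicable.\<close>
  define F where "F b = (if b then A else B)" for b
  have "independent_family UNIV F"
    unfolding independent_family_def
  proof (intro allI impI)
    fix J :: "bool set" and x :: "bool \<Rightarrow> 'b"
    assume *: "finite J \<and> J \<subseteq> UNIV \<and> (\<forall>j\<in>J. x j \<in> F j) \<and> (\<Sum>j\<in>J. x j) = 0"
    \<comment> \<open>Padding by 0 outside \<open>J\<close> turns the sum over an arbitrary set of
      indices into a sum of exactly two terms.\<close>
    define y where "y b = (if b \<in> J then x b else 0)" for b
    have "(\<Sum>b\<in>UNIV. y b) = (\<Sum>b\<in>J. x b)"
      unfolding y_def by (simp add: sum.If_cases)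
    then have "y True + y False = 0" using * by (simp add: UNIV_bool add.commute)
    moreover have "y True \<in> A" "y False \<in> B"
      using * AB by (auto simp: y_def F_def subspace_0)
    ultimately have "y True \<in> A \<inter> B"
      using AB(2) by (metis IntI eq_neg_iff_add_eq_0 subspace_neg)
    then have "y True = 0" using AB(3) by simp
    moreover from this have "y False = 0" using \<open>y True + y False = 0\<close> by simp
    ultimately have "y b = 0" for b by (cases b) auto
    then show "\<forall>j\<in>J. x j = 0" by (metis y_def)
  qed
  then have "independent (\<Union>b\<in>UNIV. if b then C else D)"
  proof (rule independent_UN)
    fix b
    show "subspace (F b)" by (simp add: F_def AB)
    show "(if b then C else D) \<subseteq> F b" using C D span_superset by (auto simp: F_def)
    show "independent (if b then C else D)" using C D by simp
  qed
  then show "independent (C \<union> D)" by (simp add: UNIV_bool Un_commute)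
qed

text \<open>In matrix terms: if row \<open>x\<close> of \<open>g\<close> has no nonzero entry except
  possibly \<open>c\<close> in column \<open>w\<close>, then coordinate \<open>x\<close> of
  \<open>g z\<close> is \<open>c\<close> times coordinate \<open>w\<close> of \<open>z\<close>. A
  zero row is the case \<open>c = 0\<close>, with any \<open>w\<close>.\<close>

lemma (in vector_space) representation_linear_image:
  assumes X: "independent X" and g: "Vector_Spaces.linear scale scale g" "g ` span X \<subseteq> span X"
    and gX: "\<And>y. y \<in> X \<Longrightarrow> representation X (g y) x = (if y = w then c else 0)"
    and z: "z \<in> span X"
  shows "representation X (g z) x = c * representation X z w"
proof -
  interpret g: Vector_Spaces.linear scale scale g by fact
  \<comment> \<open>Membership in the span is carried through the induction because
    \<open>representation\<close> is known to be additive only there.\<close>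
  have "z \<in> span X \<and> representation X (g z) x = c * representation X z w"
    using z
  proof (induction rule: span_induct_alt)
    case base
    then show ?case by (simp add: g.zero representation_zero span_zero)
  next
    case (step k y z)
    have y: "y \<in> span X" "g y \<in> span X" and z: "z \<in> span X" "g z \<in> span X"
      using step g(2) span_base[of y X] by auto
    have "k *s y + z \<in> span X" using y z by (intro span_add span_scale)
    moreover have "representation X (g (k *s y + z)) x = k * representation X (g y) x + representation X (g z) x"
      using y z by (simp add: g.add g.scale span_scale representation_add[OF X] representation_scale[OF X])
    moreover have "representation X (k *s y + z) w = k * representation X y w + representation X z w"
      using y z by (simp add: span_scale representation_add[OF X] representation_scale[OF X])
    moreover have "representation X y w = (if y = w then 1 else 0)"
      using representation_basis[OF X step(1)] by simp
    ultimately show ?case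
      using step(2) gX[OF step(1)] by (simp add: algebra_simps)
  qed
  then show ?thesis ..
qed

section \<open>Coordinates as finitely supported functions; transport of representations\<close>

lemma lookup_finsupp_scale:
  "Poly_Mapping.lookup (finsupp_scale k \<phi>) x = k * Poly_Mapping.lookup \<phi> x"
  by (simp add: finsupp_scale_def map.rep_eq when_def)

text \<open>\<open>representation\<close> is 0 when \<open>X\<close> is dependent or
  \<open>z\<close> lies outside \<open>span X\<close>, so its support is always finite and
  \<open>Abs_poly_mapping\<close> is applied to a legitimate argument.\<close>

definition coordinates ::
  "('k::field \<Rightarrow> 'a::ab_group_add \<Rightarrow> 'a) \<Rightarrow> 'a set \<Rightarrow> 'a \<Rightarrow> 'a \<Rightarrow>\<^sub>0 'k" where
  "coordinates sc X z = Abs_poly_mapping (module.representation sc X z)"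

context vector_space
begin

lemma lookup_coordinates [simp]: "Poly_Mapping.lookup (coordinates scale X z) = representation X z"
  unfolding coordinates_def by (rule lookup_Abs_poly_mapping) (rule finite_representation)

lemma linear_map_on_coordinates:
  assumes "independent X"
  shows "linear_map_on scale (span X) finsupp_scale (finsupp_module X) (coordinates scale X)"
  unfolding linear_map_on_def
proof (intro conjI ballI allI)
  show "coordinates scale X ` span X \<subseteq> finsupp_module X"
    using representation_ne_zero by (auto simp: finsupp_module_def in_keys_iff)
qed (auto intro!: poly_mapping_eqI simp: lookup_add lookup_finsupp_scale
    representation_add[OF assms] representation_scale[OF assms])

lemma bij_betw_coordinates:
  assumes X: "independent X"
  shows "bij_betw (coordinates scale X) (span X) (finsupp_module X)"
  unfolding bij_betw_def
proof (intro conjI antisym)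
  show "coordinates scale X ` span X \<subseteq> finsupp_module X"
    using linear_map_on_coordinates[OF X] by (simp add: linear_map_on_def)
  show "inj_on (coordinates scale X) (span X)"
  proof (rule inj_onI)
    fix y z assume "y \<in> span X" "z \<in> span X" "coordinates scale X y = coordinates scale X z"
    then show "y = z"
      using sum_nonzero_representation_eq[OF X, of y] sum_nonzero_representation_eq[OF X, of z]
      by (simp flip: lookup_coordinates)
  qed
  show "finsupp_module X \<subseteq> coordinates scale X ` span X"
  proof
    fix \<phi> :: "'b \<Rightarrow>\<^sub>0 'a" assume \<phi>: "\<phi> \<in> finsupp_module X"
    let ?z = "\<Sum>b | Poly_Mapping.lookup \<phi> b \<noteq> 0. Poly_Mapping.lookup \<phi> b *s b"
    have k: "b \<in> X" if "Poly_Mapping.lookup \<phi> b \<noteq> 0" for b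
      using \<phi> that by (auto simp: finsupp_module_def in_keys_iff)
    have z: "?z \<in> span X" by (intro span_sum span_scale span_base) (simp add: k)
    have "representation X ?z = Poly_Mapping.lookup \<phi>"
      by (rule representation_eqI[OF X z k]) (simp_all add: finite_lookup)
    then have "coordinates scale X ?z = \<phi>" by (intro poly_mapping_eqI) simp
    then show "\<phi> \<in> coordinates scale X ` span X" by (intro rev_image_eqI[OF z]) simp
  qed
qed

end

text \<open>Conjugation by an isomorphism preserves the laws of a representation. The set
  \<open>lpa E\<close> has to be closed under its operations so that the intertwining relation can
  be used for sums, multiples and products.\<close>

lemma lpa_rep_transport:
  fixes sc :: "'k::field \<Rightarrow> 'a::ab_group_add \<Rightarrow> 'a" and E :: "('v, 'e) pre_digraph"
  assumes vs: "vector_space sc"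
    and M: "module.subspace sc M" and \<Phi>: "lpa_rep E sc M \<Phi>"
    and U: "linear_map_on sc M sc' N U" "bij_betw U M N"
    and \<pi>: "\<And>a z. a \<in> lpa E \<Longrightarrow> z \<in> M \<Longrightarrow> \<pi> a (U z) = U (\<Phi> a z)"
  shows "lpa_rep E sc' N \<pi>"
proof -
  interpret vector_space sc by fact
  have U_add: "U (y + z) = U y + U z" if "y \<in> M" "z \<in> M" for y z
    using U(1) that by (auto simp: linear_map_on_def)
  have U_sc: "U (sc k z) = sc' k (U z)" and U_in: "U z \<in> N" if "z \<in> M" for z k
    using U(1) that by (auto simp: linear_map_on_def)
  have linear: "linear_map_on sc M sc M (\<Phi> a)" if "a \<in> lpa E" for a
    using \<Phi> that by (simp add: lpa_rep_def)
  have \<Phi>_M: "\<Phi> a z \<in> M" and \<Phi>_sc: "\<Phi> a (sc k z) = sc k (\<Phi> a z)"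
    if "a \<in> lpa E" "z \<in> M" for a z k
    using linear[OF that(1)] that(2) by (auto simp: linear_map_on_def)
  have \<Phi>_add: "\<Phi> a (y + z) = \<Phi> a y + \<Phi> a z" if "a \<in> lpa E" "y \<in> M" "z \<in> M" for a y z
    using linear[OF that(1)] that(2,3) by (auto simp: linear_map_on_def)
  have M_add: "y + z \<in> M" if "y \<in> M" "z \<in> M" for y z
    using M that by (rule subspace_add)
  have M_sc: "sc k z \<in> M" if "z \<in> M" for z k
    using M that by (rule subspace_scale)
  have in_lpaE: "\<exists>a'\<in>lpa_terms E. a = lpa_class E a'" if "a \<in> lpa E" for a :: "('k, 'v, 'e) lpa_term set"
    using that by (auto simp: lpa_def lpa_class_def elim!: quotientE)
  have plus: "lpa_plus E a b \<in> lpa E" and times: "lpa_times E a b \<in> lpa E"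
    if "a \<in> lpa E" "b \<in> lpa E" for a b :: "('k, 'v, 'e) lpa_term set"
    using in_lpaE[OF that(1)] in_lpaE[OF that(2)]
    by (auto simp: lpa_plus_class lpa_times_class intro!: lpa_class_in_lpa lpa_terms.intros)
  have scale: "lpa_scale E k a \<in> lpa E" if "a \<in> lpa E" for a :: "('k, 'v, 'e) lpa_term set" and k
    using in_lpaE[OF that] by (auto simp: lpa_scale_class intro!: lpa_class_in_lpa lpa_terms.intros)
  \<comment> \<open>With \<open>N\<close> written as an image, every element of it appears as
    \<open>U z\<close>, and each law for \<open>\<pi>\<close> reduces to the one for
    \<open>\<Phi>\<close> on \<open>M\<close>.\<close>
  have N: "N = U ` M" using U(2) by (simp add: bij_betw_def)
  show ?thesis
    unfolding lpa_rep_def linear_map_on_def N ball_simps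
  proof (intro conjI ballI allI)
    fix a :: "('k, 'v, 'e) lpa_term set" assume a: "a \<in> lpa E"
    show "\<pi> a ` U ` M \<subseteq> U ` M" using a by (auto simp: \<pi> \<Phi>_M)
    fix z k assume z: "z \<in> M"
    show "\<pi> a (sc' k (U z)) = sc' k (\<pi> a (U z))"
      using a z by (simp add: \<pi> \<Phi>_M M_sc \<Phi>_sc flip: U_sc)
    show "\<pi> (lpa_scale E k a) (U z) = sc' k (\<pi> a (U z))"
      using a z \<Phi> by (simp add: \<pi> scale \<Phi>_M lpa_rep_def flip: U_sc)
    fix b :: "('k, 'v, 'e) lpa_term set" assume b: "b \<in> lpa E"
    show "\<pi> (lpa_plus E a b) (U z) = \<pi> a (U z) + \<pi> b (U z)"
      using a b z \<Phi> by (simp add: \<pi> plus \<Phi>_M lpa_rep_def flip: U_add)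
    show "\<pi> (lpa_times E a b) (U z) = \<pi> a (\<pi> b (U z))"
      using a b z \<Phi> by (simp add: \<pi> times \<Phi>_M lpa_rep_def)
  next
    fix a :: "('k, 'v, 'e) lpa_term set" and y z assume "a \<in> lpa E" "y \<in> M" "z \<in> M"
    then show "\<pi> a (U y + U z) = \<pi> a (U y) + \<pi> a (U z)"
      by (simp add: \<pi> \<Phi>_M M_add \<Phi>_add flip: U_add)
  qed
qed

lemma independent_family_mono:
  "independent_family I A \<Longrightarrow> J \<subseteq> I \<Longrightarrow> independent_family J A"
  unfolding independent_family_def by (meson order_trans)

section \<open>Operators of a representation and their ranges\<close>

locale lpa_representation = wf_digraph E + vector_space sc
  for E :: "('v, 'e) pre_digraph" and sc :: "'k::field \<Rightarrow> 'a::ab_group_add \<Rightarrow> 'a" +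
  fixes \<Phi> :: "('k, 'v, 'e) lpa_term set \<Rightarrow> 'a \<Rightarrow> 'a"
  assumes rep: "lpa_rep E sc UNIV \<Phi>"
begin

abbreviation P :: "'v \<Rightarrow> 'a \<Rightarrow> 'a" where "P v \<equiv> \<Phi> (lpa_vertex E v)"
abbreviation S :: "'e \<Rightarrow> 'a \<Rightarrow> 'a" where "S e \<equiv> \<Phi> (lpa_edge E e)"
abbreviation T :: "'e \<Rightarrow> 'a \<Rightarrow> 'a" where "T e \<equiv> \<Phi> (lpa_ghost E e)"

lemma linear_rep: "a \<in> lpa E \<Longrightarrow> Vector_Spaces.linear sc sc (\<Phi> a)"
  using rep by unfold_locales (auto simp: lpa_rep_def linear_map_on_def)

lemma linear_P: "v \<in> verts E \<Longrightarrow> Vector_Spaces.linear sc sc (P v)"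
  and linear_S: "e \<in> arcs E \<Longrightarrow> Vector_Spaces.linear sc sc (S e)"
  and linear_T: "e \<in> arcs E \<Longrightarrow> Vector_Spaces.linear sc sc (T e)"
  by (intro linear_rep lpa_class_in_lpa lpa_terms.intros; assumption)+

lemma map_zero:
  "v \<in> verts E \<Longrightarrow> P v 0 = 0" "e \<in> arcs E \<Longrightarrow> S e 0 = 0" "e \<in> arcs E \<Longrightarrow> T e 0 = 0"
  by (fact module_hom.zero[OF linear_P[unfolded linear_iff_module_hom]]
      module_hom.zero[OF linear_S[unfolded linear_iff_module_hom]]
      module_hom.zero[OF linear_T[unfolded linear_iff_module_hom]])+

lemma rep_Plus:
  assumes "a \<in> lpa_terms E" "b \<in> lpa_terms E"
  shows "\<Phi> (lpa_class E (Plus a b)) x = \<Phi> (lpa_class E a) x + \<Phi> (lpa_class E b) x"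
  using rep assms lpa_class_in_lpa[of a E] lpa_class_in_lpa[of b E]
  by (simp add: lpa_rep_def lpa_plus_class[symmetric])

lemma rep_Scale:
  assumes "a \<in> lpa_terms E"
  shows "\<Phi> (lpa_class E (Scale k a)) x = sc k (\<Phi> (lpa_class E a) x)"
  using rep assms lpa_class_in_lpa[of a E]
  by (simp add: lpa_rep_def lpa_scale_class[symmetric])

lemmas rep_Times = lpa_rep_Times[OF rep]
lemmas rep_Zero = lpa_rep_Zero[OF rep UNIV_I]

lemma P_P: "v \<in> verts E \<Longrightarrow> w \<in> verts E \<Longrightarrow> P v (P w x) = (if v = w then P v x else 0)"
  by (auto simp: rep_Times lpa_terms.intros lpa_class_eq[OF lpa_eq.Vertex_idem]
      lpa_class_eq[OF lpa_eq.Vertex_orthogonal] rep_Zero)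

lemma P_S: "e \<in> arcs E \<Longrightarrow> P (tail E e) (S e x) = S e x"
  and S_P: "e \<in> arcs E \<Longrightarrow> S e (P (head E e) x) = S e x"
  and P_T: "e \<in> arcs E \<Longrightarrow> P (head E e) (T e x) = T e x"
  and T_P: "e \<in> arcs E \<Longrightarrow> T e (P (tail E e) x) = T e x"
  by (simp_all add: rep_Times lpa_terms.intros lpa_class_eq[OF lpa_eq.tail_Edge]
      lpa_class_eq[OF lpa_eq.Edge_head] lpa_class_eq[OF lpa_eq.head_Ghost] lpa_class_eq[OF lpa_eq.Ghost_tail])

lemma T_S: "e \<in> arcs E \<Longrightarrow> f \<in> arcs E \<Longrightarrow> T e (S f x) = (if e = f then P (head E e) x else 0)"
  by (auto simp: rep_Times lpa_terms.intros lpa_class_eq[OF lpa_eq.Ghost_Edge_same]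
      lpa_class_eq[OF lpa_eq.Ghost_Edge_diff] rep_Zero)

lemma P_eq_sum:
  assumes "v \<in> verts E" "finite (out_arcs E v)" "out_arcs E v \<noteq> {}"
  shows "P v x = (\<Sum>e\<in>out_arcs E v. S e (T e x))"
proof -
  obtain es where es: "distinct es" "set es = out_arcs E v"
    using finite_distinct_list[OF assms(2)] by blast
  \<comment> \<open>The relation for a regular vertex is a right-nested sum over a list. It is
    evaluated summand by summand; distinctness of the list turns it into a sum over a set.\<close>
  have foldr: "\<Phi> (lpa_class E (foldr (\<lambda>e. Plus (Times (Edge e) (Ghost e))) fs Zero)) x = (\<Sum>e\<in>set fs. S e (T e x))"
    if "distinct fs" "set fs \<subseteq> arcs E" for fs
    using that
    by (induction fs) (simp_all add: rep_Zero rep_Plus lpa_terms_foldr lpa_terms.intros rep_Times)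
  have "es \<noteq> []" using es assms(3) by auto
  have "lpa_vertex E v = (lpa_class E (foldr (\<lambda>e. Plus (Times (Edge e) (Ghost e))) es Zero)
      :: ('k, 'v, 'e) lpa_term set)"
    by (rule lpa_class_eq[OF lpa_eq.Vertex_sum]) fact+
  then have "P v x = \<Phi> (lpa_class E (foldr (\<lambda>e. Plus (Times (Edge e) (Ghost e))) es Zero)) x"
    by simp
  also have "\<dots> = (\<Sum>e\<in>set es. S e (T e x))"
    by (rule foldr) (use es in \<open>auto simp: out_arcs_def\<close>)
  finally show ?thesis by (simp add: es)
qed

lemma P_vertex_space: "v \<in> verts E \<Longrightarrow> x \<in> vertex_space E \<Phi> v \<Longrightarrow> P v x = x"
  by (auto simp: vertex_space_def P_P)

lemma subspace_vertex_space: "v \<in> verts E \<Longrightarrow> subspace (vertex_space E \<Phi> v)"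
  unfolding vertex_space_def
  by (rule module_hom.subspace_image[OF linear_P[unfolded linear_iff_module_hom] subspace_UNIV])

text \<open>This presents \<open>V_e\<close> as a copy of the vertex space at the head of
  \<open>e\<close>, so that \<open>S e\<close> can carry a basis of one to a basis of the other. It
  rests on \<open>T e\<close> mapping into that vertex space and on \<open>T e\<close> undoing
  \<open>S e\<close> there.\<close>

lemma edge_space_eq:
  assumes "e \<in> arcs E"
  shows "edge_space E \<Phi> e = S e ` vertex_space E \<Phi> (head E e)"
proof -
  have "S e (T e x) \<in> S e ` vertex_space E \<Phi> (head E e)" for x
    using P_T[OF assms, of x] unfolding vertex_space_def by (metis imageI rangeI)
  moreover have "S e (P (head E e) x) = S e (T e (S e x))" for x
    using assms by (simp add: T_S)
  ultimately show ?thesis by (auto simp: edge_space_def vertex_space_def)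
qed

lemma subspace_edge_space: "e \<in> arcs E \<Longrightarrow> subspace (edge_space E \<Phi> e)"
  by (simp only: edge_space_eq head_in_verts subspace_vertex_space
      module_hom.subspace_image[OF linear_S[unfolded linear_iff_module_hom]])

lemma inj_on_S: "e \<in> arcs E \<Longrightarrow> inj_on (S e) (vertex_space E \<Phi> (head E e))"
  by (rule inj_on_inverseI[where g = "T e"]) (simp add: T_S P_vertex_space)

text \<open>The relation \<open>P v = \<Sum> S e T e\<close> splits each vector of
  \<open>V_v\<close> into components in the edge spaces, so at such a vertex the complement is
  zero.\<close>

lemma edge_spaces_exhaust:
  assumes "v \<in> verts E" "finite (out_arcs E v)" "out_arcs E v \<noteq> {}"
  shows "subspace_sum sc (out_arcs E v) (edge_space E \<Phi>) = vertex_space E \<Phi> v"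
proof
  have "edge_space E \<Phi> e \<subseteq> vertex_space E \<Phi> v" if "e \<in> out_arcs E v" for e
  proof
    fix x assume "x \<in> edge_space E \<Phi> e"
    then obtain y where "x = S e (T e y)" by (auto simp: edge_space_def)
    then have "x = P v x" using that P_S[of e "T e y"] by (simp add: out_arcs_def)
    then show "x \<in> vertex_space E \<Phi> v" by (auto simp: vertex_space_def)
  qed
  then show "subspace_sum sc (out_arcs E v) (edge_space E \<Phi>) \<subseteq> vertex_space E \<Phi> v"
    unfolding subspace_sum_def by (intro span_minimal subspace_vertex_space assms UN_least)
  show "vertex_space E \<Phi> v \<subseteq> subspace_sum sc (out_arcs E v) (edge_space E \<Phi>)"
  proof
    fix x assume "x \<in> vertex_space E \<Phi> v"
    then have "x = (\<Sum>e\<in>out_arcs E v. S e (T e x))"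
      using P_eq_sum[OF assms] P_vertex_space[OF assms(1)] by simp
    also have "\<dots> \<in> subspace_sum sc (out_arcs E v) (edge_space E \<Phi>)"
      unfolding subspace_sum_def by (intro span_sum span_base UN_I) (auto simp: edge_space_def)
    finally show "x \<in> subspace_sum sc (out_arcs E v) (edge_space E \<Phi>)" .
  qed
qed

text \<open>Each generator is fixed under left multiplication by some vertex idempotent, hence has
  its values in one vertex space. A product inherits the property from its left factor.\<close>

lemma rep_in_support:
  assumes "a \<in> lpa E"
  shows "\<Phi> a x \<in> rep_support E sc \<Phi>"
proof -
  have W: "P v x \<in> rep_support E sc \<Phi>" if "v \<in> verts E" for v x
    unfolding rep_support_def subspace_sum_def using that by (intro span_base) (auto simp: vertex_space_def)
  have sub: "subspace (rep_support E sc \<Phi>)"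
    unfolding rep_support_def subspace_sum_def by (rule subspace_span)
  obtain t where "t \<in> lpa_terms E" "a = lpa_class E t"
    using assms by (auto simp: lpa_def lpa_class_def elim!: quotientE)
  moreover from this(1) have "\<Phi> (lpa_class E t) x \<in> rep_support E sc \<Phi>"
  proof (induction arbitrary: x)
    case (Edge e)
    then show ?case using W[of "tail E e" "S e x"] by (simp add: P_S)
  next
    case (Ghost e)
    then show ?case using W[of "head E e" "T e x"] by (simp add: P_T)
  next
    case (Times a b)
    then show ?case by (simp flip: rep_Times)
  qed (simp_all add: W rep_Zero rep_Plus rep_Scale subspace_0[OF sub] subspace_add[OF sub] subspace_scale[OF sub])
  ultimately show ?thesis by simp
qed

section \<open>Bases of the vertex spaces and the branching system they carry\<close>

text \<open>The elements are the vectors \<open>S e1 (... (S en c))\<close> for a directed walk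
  \<open>e1 ... en\<close> starting at \<open>u\<close> and \<open>c\<close> in \<open>C\<close> of
  its last vertex. As a least fixed point the set exists for any graph; well-foundedness enters when
  it is shown to be a basis.\<close>

inductive vertex_basis :: "('v \<Rightarrow> 'a set) \<Rightarrow> 'v \<Rightarrow> 'a \<Rightarrow> bool" for C where
  base: "x \<in> C u \<Longrightarrow> vertex_basis C u x"
| step: "e \<in> arcs E \<Longrightarrow> vertex_basis C (head E e) x \<Longrightarrow> vertex_basis C (tail E e) (S e x)"

abbreviation B :: "('v \<Rightarrow> 'a set) \<Rightarrow> 'v \<Rightarrow> 'a set" where
  "B C u \<equiv> Collect (vertex_basis C u)"

lemma vertex_basis_eq: "B C u = C u \<union> (\<Union>e\<in>out_arcs E u. S e ` B C (head E e))"
proof (intro set_eqI iffI)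
  fix x assume "x \<in> B C u"
  then have "vertex_basis C u x" by simp
  then show "x \<in> C u \<union> (\<Union>e\<in>out_arcs E u. S e ` B C (head E e))"
    by cases (auto simp: out_arcs_def)
next
  fix x assume "x \<in> C u \<union> (\<Union>e\<in>out_arcs E u. S e ` B C (head E e))"
  then show "x \<in> B C u" by (auto simp: out_arcs_def intro: base step)
qed

text \<open>The induction passes from heads to tails. The map \<open>S e\<close> is injective on the
  vertex space at the head, so it carries the basis there to one of \<open>V_e\<close>; the edge
  spaces at \<open>u\<close> are independent, and \<open>C u\<close> supplies a basis of the
  complement of their sum.\<close>

lemma vertex_basis_basis:
  assumes wf: "wf {(head E e, tail E e) |e. e \<in> arcs E}"
    and indep: "\<And>u. u \<in> verts E \<Longrightarrow> independent (C u)"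
    and compl: "\<And>u. u \<in> verts E \<Longrightarrow>
      is_complement sc (subspace_sum sc (out_arcs E u) (edge_space E \<Phi>)) (span (C u)) (vertex_space E \<Phi> u)"
    and "u \<in> verts E"
  shows "independent (B C u) \<and> span (B C u) = vertex_space E \<Phi> u"
  using wf \<open>u \<in> verts E\<close>
proof (induction u rule: wf_induct_rule)
  case (less u)
  let ?D = "\<lambda>e. S e ` B C (head E e)"
  have out: "e \<in> arcs E" "tail E e = u" if "e \<in> out_arcs E u" for e
    using that by (auto simp: out_arcs_def)
  have D: "independent (?D e)" "span (?D e) = edge_space E \<Phi> e" if "e \<in> out_arcs E u" for e
  proof -
    interpret S: Vector_Spaces.linear sc sc "S e" using linear_S out[OF that] by simp
    have IH: "independent (B C (head E e))" "span (B C (head E e)) = vertex_space E \<Phi> (head E e)"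
      using less.IH[of "head E e"] out[OF that] by auto
    show "span (?D e) = edge_space E \<Phi> e"
      using out[OF that] by (simp add: S.span_image IH edge_space_eq)
    show "independent (?D e)"
      using IH inj_on_S[OF out(1)[OF that]] by (intro S.independent_injective_image) simp_all
  qed
  have "independent (\<Union>e\<in>out_arcs E u. ?D e)"
  proof (rule independent_UN)
    show "independent_family (out_arcs E u) (edge_space E \<Phi>)"
      using independent_edge_spaces[OF wf_digraph_axioms rep] by (rule independent_family_mono) (auto dest: out)
    fix e assume e: "e \<in> out_arcs E u"
    show "subspace (edge_space E \<Phi> e)" using out[OF e] by (simp add: subspace_edge_space)
    show "?D e \<subseteq> edge_space E \<Phi> e" using span_superset[of "?D e"] D(2)[OF e] by simp
    show "independent (?D e)" by (rule D(1)[OF e])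
  qed
  moreover have "span (\<Union>e\<in>out_arcs E u. ?D e) = subspace_sum sc (out_arcs E u) (edge_space E \<Phi>)"
    using span_UN_span[of ?D "out_arcs E u"] D(2) by (simp add: subspace_sum_def)
  ultimately have "independent ((\<Union>e\<in>out_arcs E u. ?D e) \<union> C u)"
    "span ((\<Union>e\<in>out_arcs E u. ?D e) \<union> C u) = vertex_space E \<Phi> u"
    by (rule basis_of_complement[OF compl[OF less.prems] _ _ indep[OF less.prems] HOL.refl])+
  then show ?case
    \<comment> \<open>The equation is recursive, so it is applied only to the two visible
      occurrences of \<open>B C u\<close>.\<close>
    by (subst (1 2) vertex_basis_eq) (simp add: Un_commute)
qed

text \<open>On a basis that the generators permute up to 0, their matrices have entries 0 and 1 with
  at most one 1 in each row. Reading off the position of that 1 gives exactly the formulas of an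
  induced representation. \<open>X\<close> may contain vectors outside every \<open>D v\<close>; all
  generators kill them.\<close>

lemma induced_by_branching_system:
  fixes \<Psi> :: "('k, 'v, 'e) lpa_term set \<Rightarrow> 'a \<Rightarrow> 'a"
  assumes X: "independent X"
    and closed: "\<And>a x. a \<in> lpa E \<Longrightarrow> x \<in> span X \<Longrightarrow> \<Phi> a x \<in> span X"
    and D: "\<And>v. v \<in> verts E \<Longrightarrow> D v \<subseteq> X"
    and P_D: "\<And>v x. v \<in> verts E \<Longrightarrow> x \<in> D v \<Longrightarrow> P v x = x"
    and P_not_D: "\<And>v x. v \<in> verts E \<Longrightarrow> x \<in> X - D v \<Longrightarrow> P v x = 0"
    and S_D: "\<And>e. e \<in> arcs E \<Longrightarrow> S e ` D (head E e) \<subseteq> D (tail E e)"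
    and T_D: "\<And>e x. e \<in> arcs E \<Longrightarrow> x \<in> D (tail E e) - S e ` D (head E e) \<Longrightarrow> T e x = 0"
    and regular: "\<And>v. v \<in> verts E \<Longrightarrow> finite (out_arcs E v) \<Longrightarrow> out_arcs E v \<noteq> {} \<Longrightarrow>
      D v = (\<Union>e\<in>out_arcs E v. S e ` D (head E e))"
    and \<Psi>: "\<And>a x. a \<in> lpa E \<Longrightarrow> x \<in> span X \<Longrightarrow> \<Psi> a x = \<Phi> a x"
  shows "\<exists>(Y :: 'a set) R D f \<pi>.
    algebraic_branching_system E Y R D f \<and> is_induced_rep E Y R D f \<pi> \<and>
    equivalent_reps E finsupp_scale (finsupp_module Y) \<pi> sc (span X) \<Psi>"
proof -
  define R where "R e = S e ` D (head E e)" for e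
  \<comment> \<open>Nonzero basis vectors are what turns orthogonality of the operators into
    disjointness of the sets \<open>R e\<close> and \<open>D v\<close>.\<close>
  have zero: "0 \<notin> X" using X dependent_zero[of X] by (rule contrapos_nn)
  have TS: "T e (S e x) = x" if "e \<in> arcs E" "x \<in> D (head E e)" for e x
    using that T_S[of e e x] P_D[of "head E e" x] by simp
  then have inj: "inj_on (S e) (D (head E e))" if "e \<in> arcs E" for e
    using that by (intro inj_on_inverseI[where g = "T e"]) simp
  have S_not_D: "S e x = 0" if "e \<in> arcs E" "x \<in> X - D (head E e)" for e x
    using S_P[OF that(1), of x] P_not_D[of "head E e" x] that by (simp add: map_zero)
  have T_not_R: "T e x = 0" if "e \<in> arcs E" "x \<in> X - R e" for e x
  proof (cases "x \<in> D (tail E e)")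
    case True
    then show ?thesis using that T_D by (simp add: R_def)
  next
    case False
    then show ?thesis
      using T_P[OF that(1), of x] P_not_D[of "tail E e" x] that by (simp add: map_zero)
  qed
  have RD: "R e \<subseteq> D (tail E e)" and RX: "R e \<subseteq> X" if "e \<in> arcs E" for e
    using S_D[OF that] D[of "tail E e"] that by (auto simp: R_def)
  have bs: "algebraic_branching_system E X R D S"
    unfolding algebraic_branching_system_def
  proof (intro conjI ballI impI)
    show "disjoint_family_on R (arcs E)"
      unfolding disjoint_family_on_def
    proof (intro ballI impI)
      fix e f assume e: "e \<in> arcs E" and f: "f \<in> arcs E" and "e \<noteq> f"
      have False if "x \<in> R e" "x \<in> R f" for x
      proof -
        obtain y z where y: "y \<in> D (head E e)" "x = S e y" and z: "z \<in> D (head E f)" "x = S f z"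
          using \<open>x \<in> R e\<close> \<open>x \<in> R f\<close> by (auto simp: R_def)
        then have "y = 0" using TS[OF e y(1)] T_S[OF e f, of z] \<open>e \<noteq> f\<close> by simp
        then show False using y(1) D[of "head E e"] e zero by auto
      qed
      then show "R e \<inter> R f = {}" by blast
    qed
    show "disjoint_family_on D (verts E)"
      unfolding disjoint_family_on_def
    proof (intro ballI impI)
      fix v w assume v: "v \<in> verts E" and w: "w \<in> verts E" and "v \<noteq> w"
      have False if "x \<in> D v" "x \<in> D w" for x
      proof -
        have "x = 0" using P_D[OF v that(1)] P_D[OF w that(2)] P_P[OF v w, of x] \<open>v \<noteq> w\<close> by simp
        then show False using D[OF v] that(1) zero by auto
      qed
      then show "D v \<inter> D w = {}" by blast
    qed
    show "D v = (\<Union>e\<in>out_arcs E v. R e)" if "v \<in> verts E" "finite (out_arcs E v) \<and> out_arcs E v \<noteq> {}" for v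
      using regular that by (simp add: R_def)
    show "bij_betw (S e) (D (head E e)) (R e)" if "e \<in> arcs E" for e
      using inj[OF that] by (simp add: bij_betw_def R_def)
  qed (use RX RD D in auto)
  let ?U = "coordinates sc X"
  have U: "linear_map_on sc (span X) finsupp_scale (finsupp_module X) ?U"
    "bij_betw ?U (span X) (finsupp_module X)"
    by (rule linear_map_on_coordinates[OF X], rule bij_betw_coordinates[OF X])
  \<comment> \<open>This is \<open>\<Phi>\<close> expressed in coordinates; outside
    \<open>finsupp_module X\<close> its values are irrelevant.\<close>
  define \<pi> where "\<pi> a \<phi> = ?U (\<Phi> a (the_inv_into (span X) ?U \<phi>))" for a :: "('k, 'v, 'e) lpa_term set" and \<phi>
  have \<pi>_U: "\<pi> a (?U z) = ?U (\<Phi> a z)" if "z \<in> span X" for a z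
    using U(2) that by (simp add: \<pi>_def bij_betw_def the_inv_into_f_f)
  have basis: "representation X y x = (if x = y then 1 else 0)" if "y \<in> X" for x y
    using representation_basis[OF X that] by simp
  have matrix: "representation X (\<Phi> a z) x = c * representation X z w"
    if "a \<in> lpa E" "z \<in> span X"
      "\<And>y. y \<in> X \<Longrightarrow> representation X (\<Phi> a y) x = (if y = w then c else 0)" for a z x c w
    using that closed by (intro representation_linear_image X linear_rep) auto
  have edge: "representation X (S e z) x =
      (if x \<in> R e then representation X z (the_inv_into (D (head E e)) (S e) x) else 0)"
    if e: "e \<in> arcs E" and z: "z \<in> span X" for e z x
  proof -
    have S_in: "S e y \<in> X" if "y \<in> D (head E e)" for y
      using that RX[OF e] by (auto simp: R_def)
    have lpa: "lpa_edge E e \<in> (lpa E :: ('k, 'v, 'e) lpa_term set set)"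
      using e by (intro lpa_class_in_lpa lpa_terms.intros)
    show ?thesis
    proof (cases "x \<in> R e")
      case True
      then obtain w where w: "w \<in> D (head E e)" "x = S e w" by (auto simp: R_def)
      \<comment> \<open>Row \<open>x\<close> of \<open>S e\<close> has its single 1 in the column of
        \<open>w\<close>, the preimage of \<open>x\<close> under \<open>S e\<close>.\<close>
      have "representation X (S e y) x = (if y = w then 1 else 0)" if "y \<in> X" for y
      proof (cases "y \<in> D (head E e)")
        case True
        then show ?thesis using inj[OF e] w by (auto simp: basis S_in dest: inj_onD)
      next
        case False
        then show ?thesis using that w S_not_D[OF e, of y] by (auto simp: representation_zero)
      qed
      from matrix[OF lpa z this] True show ?thesis
        using w inj[OF e] by (simp add: the_inv_into_f_f)
    next
      case False
      \<comment> \<open>The row is zero. The conditional with equal branches only gives it the shape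
        expected by \<open>matrix\<close>, with \<open>c = 0\<close> and a dummy column.\<close>
      have "representation X (S e y) x = (if y = 0 then 0 else 0)" if "y \<in> X" for y
      proof (cases "y \<in> D (head E e)")
        case True
        then show ?thesis using False by (auto simp: basis S_in R_def)
      next
        case False
        then show ?thesis using that S_not_D[OF e, of y] by (simp add: representation_zero)
      qed
      from matrix[OF lpa z this] False show ?thesis by simp
    qed
  qed
  have ghost: "representation X (T e z) x = (if x \<in> D (head E e) then representation X z (S e x) else 0)"
    if e: "e \<in> arcs E" and z: "z \<in> span X" for e z x
  proof -
    have lpa: "lpa_ghost E e \<in> (lpa E :: ('k, 'v, 'e) lpa_term set set)"
      using e by (intro lpa_class_in_lpa lpa_terms.intros)
    have DX: "D (head E e) \<subseteq> X" using D e by simp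
    \<comment> \<open>Row \<open>x\<close> of \<open>T e\<close> has its 1 in column
      \<open>S e x\<close> if \<open>x\<close> lies in \<open>D (head E e)\<close>; otherwise it is
      zero and \<open>S e x\<close> is a dummy.\<close>
    have "representation X (T e y) x = (if y = S e x then if x \<in> D (head E e) then 1 else 0 else 0)"
      if "y \<in> X" for y
    proof (cases "y \<in> R e")
      case True
      then obtain v where v: "v \<in> D (head E e)" "y = S e v" by (auto simp: R_def)
      then have "T e y = v" "v \<in> X" using TS[OF e v(1)] DX by auto
      moreover have "x = v \<longleftrightarrow> x \<in> D (head E e) \<and> y = S e x"
        using v TS[OF e] by metis
      ultimately show ?thesis by (auto simp: basis)
    next
      case False
      then have "T e y = 0" "x \<in> D (head E e) \<Longrightarrow> y \<noteq> S e x"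
        using that T_not_R[OF e, of y] by (auto simp: R_def)
      then show ?thesis by (simp add: representation_zero)
    qed
    from matrix[OF lpa z this] show ?thesis by simp
  qed
  have vertex: "representation X (P v z) x = (if x \<in> D v then representation X z x else 0)"
    if v: "v \<in> verts E" and z: "z \<in> span X" for v z x
  proof -
    have lpa: "lpa_vertex E v \<in> (lpa E :: ('k, 'v, 'e) lpa_term set set)"
      using v by (intro lpa_class_in_lpa lpa_terms.intros)
    have "representation X (P v y) x = (if y = x then if x \<in> D v then 1 else 0 else 0)" if "y \<in> X" for y
      using that P_D[OF v, of y] P_not_D[OF v, of y]
      by (cases "y \<in> D v") (auto simp: basis representation_zero)
    from matrix[OF lpa z this] show ?thesis by simp
  qed
  have rep_X: "lpa_rep E sc (span X) \<Phi>"
  proof -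
    have "\<Phi> a ` span X \<subseteq> span X" if "a \<in> lpa E" for a
      using closed[OF that] by (rule image_subsetI)
    then show ?thesis using rep by (simp add: lpa_rep_def linear_map_on_def)
  qed
  have surj: "\<exists>z\<in>span X. \<phi> = ?U z" if "\<phi> \<in> finsupp_module X" for \<phi>
    using U(2) that by (auto simp: bij_betw_def)
  have "is_induced_rep E X R D S \<pi>"
    unfolding is_induced_rep_def
  proof (intro conjI ballI)
    show "lpa_rep E finsupp_scale (finsupp_module X) \<pi>"
      by (rule lpa_rep_transport[OF vector_space_axioms subspace_span rep_X U]) (rule \<pi>_U)
  next
    fix e and \<phi> :: "'a \<Rightarrow>\<^sub>0 'k" and x assume e: "e \<in> arcs E" and "\<phi> \<in> finsupp_module X"
    then obtain z where z: "z \<in> span X" "\<phi> = ?U z" using surj by blast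
    show "Poly_Mapping.lookup (\<pi> (lpa_edge E e) \<phi>) x =
        (if x \<in> R e then Poly_Mapping.lookup \<phi> (the_inv_into (D (head E e)) (S e) x) else 0)"
      unfolding z(2) \<pi>_U[OF z(1)] lookup_coordinates by (rule edge[OF e z(1)])
    show "Poly_Mapping.lookup (\<pi> (lpa_ghost E e) \<phi>) x =
        (if x \<in> D (head E e) then Poly_Mapping.lookup \<phi> (S e x) else 0)"
      unfolding z(2) \<pi>_U[OF z(1)] lookup_coordinates by (rule ghost[OF e z(1)])
  next
    fix v and \<phi> :: "'a \<Rightarrow>\<^sub>0 'k" and x assume v: "v \<in> verts E" and "\<phi> \<in> finsupp_module X"
    then obtain z where z: "z \<in> span X" "\<phi> = ?U z" using surj by blast
    show "Poly_Mapping.lookup (\<pi> (lpa_vertex E v) \<phi>) x = (if x \<in> D v then Poly_Mapping.lookup \<phi> x else 0)"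
      unfolding z(2) \<pi>_U[OF z(1)] lookup_coordinates by (rule vertex[OF v z(1)])
  qed
  moreover have "equivalent_reps E finsupp_scale (finsupp_module X) \<pi> sc (span X) \<Psi>"
    unfolding equivalent_reps_def using U \<pi>_U \<Psi> by (intro exI[of _ ?U]) simp
  ultimately show ?thesis using bs by blast
qed

end

section \<open>Choice of the complements and equivalence with an induced representation\<close>

lemma (in vector_space) subspace_has_basis:
  assumes "subspace V"
  shows "\<exists>B. independent B \<and> span B = V"
proof -
  obtain B where B: "B \<subseteq> V" "independent B" "V \<subseteq> span B" by (rule maximal_independent_subset)
  then have "span B = V" using assms by (intro span_subspace)
  with B(2) show ?thesis by blast
qed

lemma (in vector_space) is_complement_0:
  "subspace A \<Longrightarrow> is_complement scale A {0} A" "subspace A \<Longrightarrow> is_complement scale {0} A A"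
  by (auto simp: is_complement_def subspace_0)

context lpa_representation
begin

lemma ex_adapted_complement_basis:
  assumes u: "u \<in> verts E"
    and Vbar: "infinite (out_arcs E u) \<Longrightarrow>
      is_complement sc (subspace_sum sc (out_arcs E u) (edge_space E \<Phi>)) Vbar (vertex_space E \<Phi> u)"
    and Vbar_zero: "\<And>e x. infinite (out_arcs E u) \<Longrightarrow> e \<in> out_arcs E u \<Longrightarrow> x \<in> Vbar \<Longrightarrow> T e x = 0"
  shows "\<exists>C. independent C \<and>
    is_complement sc (subspace_sum sc (out_arcs E u) (edge_space E \<Phi>)) (span C) (vertex_space E \<Phi> u) \<and>
    (finite (out_arcs E u) \<and> out_arcs E u \<noteq> {} \<longrightarrow> C = {}) \<and>
    (\<forall>e\<in>out_arcs E u. \<forall>x\<in>C. T e x = 0)"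
proof -
  note V = subspace_vertex_space[OF u]
  consider (infinite) "infinite (out_arcs E u)" | (sink) "out_arcs E u = {}"
    | (regular) "finite (out_arcs E u)" "out_arcs E u \<noteq> {}" by blast
  then show ?thesis
  proof cases
    case infinite
    then have "subspace Vbar" using Vbar by (simp add: is_complement_def)
    then obtain C where C: "independent C" "span C = Vbar" using subspace_has_basis by blast
    then have "C \<subseteq> Vbar" using span_superset by blast
    then show ?thesis
      using C infinite Vbar Vbar_zero by (intro exI[of _ C]) auto
  next
    case sink
    \<comment> \<open>At a sink the empty sum of edge spaces is zero, so a basis of the whole vertex
      space is taken, and the condition on the ghosts is vacuous.\<close>
    obtain C where "independent C" "span C = vertex_space E \<Phi> u" using subspace_has_basis[OF V] by blast
    then show ?thesis
      using sink is_complement_0(2)[OF V] by (intro exI[of _ C]) (simp add: subspace_sum_def)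
  next
    case regular
    then show ?thesis
      using edge_spaces_exhaust[OF u regular] is_complement_0(1)[OF V]
      by (intro exI[of _ "{}"]) (simp add: independent_empty)
  qed
qed

text \<open>The parameters serve both claims at once: \<open>N = {}\<close> with \<open>M\<close>
  the support gives the restricted representation, and \<open>N\<close> a basis of a complement
  killed by all vertices gives \<open>\<Phi>\<close> itself. \<open>\<Psi>\<close> is separate
  because the restriction agrees with \<open>\<Phi>\<close> only on \<open>M\<close>.\<close>

lemma equivalent_to_induced_rep:
  fixes \<Psi> :: "('k, 'v, 'e) lpa_term set \<Rightarrow> 'a \<Rightarrow> 'a"
  assumes wf: "wf {(head E e, tail E e) |e. e \<in> arcs E}"
    and indep: "\<And>u. u \<in> verts E \<Longrightarrow> independent (C u)"
    and compl: "\<And>u. u \<in> verts E \<Longrightarrow>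
      is_complement sc (subspace_sum sc (out_arcs E u) (edge_space E \<Phi>)) (span (C u)) (vertex_space E \<Phi> u)"
    and regular: "\<And>u. u \<in> verts E \<Longrightarrow> finite (out_arcs E u) \<Longrightarrow> out_arcs E u \<noteq> {} \<Longrightarrow> C u = {}"
    and ghost_zero: "\<And>e x. e \<in> arcs E \<Longrightarrow> x \<in> C (tail E e) \<Longrightarrow> T e x = 0"
    and N: "independent N" "is_complement sc (rep_support E sc \<Phi>) (span N) M"
    and N_zero: "\<And>u x. u \<in> verts E \<Longrightarrow> x \<in> N \<Longrightarrow> P u x = 0"
    and \<Psi>: "\<And>a x. a \<in> lpa E \<Longrightarrow> x \<in> M \<Longrightarrow> \<Psi> a x = \<Phi> a x"
  shows "\<exists>(X :: 'a set) R D f \<pi>.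
    algebraic_branching_system E X R D f \<and> is_induced_rep E X R D f \<pi> \<and>
    equivalent_reps E finsupp_scale (finsupp_module X) \<pi> sc M \<Psi>"
proof -
  define X where "X = (\<Union>u\<in>verts E. B C u)"
  have B: "independent (B C u)" "span (B C u) = vertex_space E \<Phi> u" if "u \<in> verts E" for u
    using vertex_basis_basis[OF wf indep compl that] by auto
  then have B_sub: "B C u \<subseteq> vertex_space E \<Phi> u" if "u \<in> verts E" for u
    using span_superset[of "B C u"] that by simp
  have X: "independent X" "span X = rep_support E sc \<Phi>"
  proof -
    show "independent X"
      unfolding X_def
      by (rule independent_UN[OF independent_vertex_spaces[OF rep]])
        (simp_all add: subspace_vertex_space B B_sub)
    show "span X = rep_support E sc \<Phi>"
      using span_UN_span[of "B C" "verts E"] B(2) by (simp add: X_def rep_support_def subspace_sum_def)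
  qed
  have XN: "independent (X \<union> N)" "span (X \<union> N) = M"
    by (rule basis_of_complement[OF N(2) X N(1) HOL.refl])+
  have "\<exists>(Y :: 'a set) R D f \<pi>.
    algebraic_branching_system E Y R D f \<and> is_induced_rep E Y R D f \<pi> \<and>
    equivalent_reps E finsupp_scale (finsupp_module Y) \<pi> sc (span (X \<union> N)) \<Psi>"
  proof (rule induced_by_branching_system[where D = "B C"])
    show "independent (X \<union> N)" by (rule XN(1))
  next
    fix a :: "('k, 'v, 'e) lpa_term set" and x assume "a \<in> lpa E"
    then have "\<Phi> a x \<in> span X" using rep_in_support X(2) by simp
    then show "\<Phi> a x \<in> span (X \<union> N)" using span_mono[of X "X \<union> N"] by blast
  next
    fix v assume "v \<in> verts E"
    then show "B C v \<subseteq> X \<union> N" unfolding X_def by blast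
  next
    fix v x assume "v \<in> verts E" "x \<in> B C v"
    then show "P v x = x" using B_sub P_vertex_space by (meson subsetD)
  next
    fix v x assume v: "v \<in> verts E" and x: "x \<in> (X \<union> N) - B C v"
    show "P v x = 0"
    proof (cases "x \<in> N")
      case True
      then show ?thesis using N_zero[OF v] by simp
    next
      case False
      then obtain w where w: "w \<in> verts E" "x \<in> B C w" using x unfolding X_def by blast
      then have "P w x = x" "v \<noteq> w" using B_sub[OF w(1)] P_vertex_space x by auto
      then show ?thesis using P_P[OF v w(1), of x] by simp
    qed
  next
    fix e assume "e \<in> arcs E"
    then show "S e ` B C (head E e) \<subseteq> B C (tail E e)" by (auto intro: step)
  next
    \<comment> \<open>A basis vector at the tail of \<open>e\<close> that does not come from
      \<open>e\<close> either lies in \<open>C\<close>, where \<open>T e\<close> vanishes by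
      assumption, or comes from another arc \<open>f\<close>, where \<open>T e\<close> after
      \<open>S f\<close> is 0.\<close>
    fix e x assume e: "e \<in> arcs E" and x: "x \<in> B C (tail E e) - S e ` B C (head E e)"
    then consider "x \<in> C (tail E e)"
      | f y where "f \<in> arcs E" "x = S f y" "f \<noteq> e"
      using vertex_basis_eq[of C "tail E e"] by (auto simp: out_arcs_def)
    then show "T e x = 0"
      by cases (use e ghost_zero in \<open>auto simp: T_S\<close>)
  next
    fix v assume "v \<in> verts E" "finite (out_arcs E v)" "out_arcs E v \<noteq> {}"
    then show "B C v = (\<Union>e\<in>out_arcs E v. S e ` B C (head E e))"
      using regular vertex_basis_eq[of C v] by simp
  next
    fix a :: "('k, 'v, 'e) lpa_term set" and x assume "a \<in> lpa E" "x \<in> span (X \<union> N)"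
    then show "\<Psi> a x = \<Phi> a x" using \<Psi> XN(2) by simp
  qed
  then show ?thesis by (simp only: XN(2))
qed

end

theorem theorem6p5:
  fixes E :: "('v, 'e) pre_digraph"
    and \<Delta> :: "'i set"
    and Z :: "'i \<Rightarrow> 'v set"
    and R :: "'v set"
    and sc :: "'k::field \<Rightarrow> 'a::ab_group_add \<Rightarrow> 'a"
    and \<Phi> :: "('k, 'v, 'e) lpa_term set \<Rightarrow> 'a \<Rightarrow> 'a"
    and Vbar :: "'v \<Rightarrow> 'a set"
    and W Wbar :: "'a set"
  assumes graph: "wf_digraph E" "countable (verts E)" "countable (arcs E)"
    and no_loops: "\<forall>e\<in>arcs E. tail E e \<noteq> head E e"
    and decomposition: "verts E = (\<Union>i\<in>\<Delta>. Z i) \<union> R" "disjoint_family_on Z \<Delta>"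
      "(\<Union>i\<in>\<Delta>. Z i) \<inter> R = {}" "R = isolated_verts E" "\<forall>i\<in>\<Delta>. is_component E (Z i)"
    and levels: "\<forall>i\<in>\<Delta>. \<exists>m\<ge>1.
      Z i = (\<Union>n\<in>{1..m}. level_verts (component_graph E (Z i)) n) \<or>
      (\<exists>v. Z i = (\<Union>n\<in>{1..m}. level_verts (component_graph E (Z i)) n) \<union> {v})"
    and rep: "vector_space sc" "lpa_rep E sc UNIV \<Phi>"
    and Vbar: "\<forall>u\<in>verts E. infinite (out_arcs E u) \<longrightarrow>
      is_complement sc (subspace_sum sc (out_arcs E u) (edge_space E \<Phi>)) (Vbar u) (vertex_space E \<Phi> u)"
    and Vbar_zero: "\<forall>e\<in>arcs E. infinite (out_arcs E (tail E e)) \<longrightarrow>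
      (\<forall>x\<in>Vbar (tail E e). \<Phi> (lpa_ghost E e) x = 0)"
    and W: "W = rep_support E sc \<Phi>"
    and Wbar: "is_complement sc W Wbar UNIV"
  shows "(\<exists>(X :: 'a set) RR D f \<pi>.
            algebraic_branching_system E X RR D f \<and> is_induced_rep E X RR D f \<pi> \<and>
            equivalent_reps E finsupp_scale (finsupp_module X) \<pi> sc W (restricted_rep \<Phi> W))
       \<and> ((\<forall>u\<in>verts E. \<forall>x\<in>Wbar. \<Phi> (lpa_vertex E u) x = 0) \<longrightarrow>
          (\<exists>(X :: 'a set) RR D f \<pi>.
            algebraic_branching_system E X RR D f \<and> is_induced_rep E X RR D f \<pi> \<and>
            equivalent_reps E finsupp_scale (finsupp_module X) \<pi> sc UNIV \<Phi>))"
proof -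
  interpret lpa_representation E sc \<Phi>
    by (intro lpa_representation.intro lpa_representation_axioms.intro graph(1) rep)
  have wf: "wf {(head E e, tail E e) |e. e \<in> arcs E}"
  proof (rule wf_arcs_if_finite_levels[OF graph(1)])
    fix v assume "v \<in> verts E - isolated_verts E"
    then obtain i where i: "i \<in> \<Delta>" "v \<in> Z i" using decomposition(1,4) by blast
    obtain m w where "Z i = (\<Union>n\<in>{1..m}. level_verts (component_graph E (Z i)) n) \<or>
        Z i = (\<Union>n\<in>{1..m}. level_verts (component_graph E (Z i)) n) \<union> {w}"
      using levels i(1) by blast
    \<comment> \<open>The inclusion covers both alternatives for \<open>Z i\<close>; in the first
      one \<open>w\<close> is arbitrary.\<close>
    then have "Z i \<subseteq> insert w (\<Union>n\<in>{1..m}. level_verts (component_graph E (Z i)) n)" by blast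
    then show "\<exists>Z m w. v \<in> Z \<and> is_component E Z \<and>
        Z \<subseteq> insert w (\<Union>n\<in>{1..m}. level_verts (component_graph E Z) n)"
      using i decomposition(5) by blast
  qed (use no_loops in blast)
  have "\<forall>u\<in>verts E. \<exists>C. independent C \<and>
    is_complement sc (subspace_sum sc (out_arcs E u) (edge_space E \<Phi>)) (span C) (vertex_space E \<Phi> u) \<and>
    (finite (out_arcs E u) \<and> out_arcs E u \<noteq> {} \<longrightarrow> C = {}) \<and>
    (\<forall>e\<in>out_arcs E u. \<forall>x\<in>C. \<Phi> (lpa_ghost E e) x = 0)"
  proof
    fix u assume u: "u \<in> verts E"
    show "\<exists>C. independent C \<and>
      is_complement sc (subspace_sum sc (out_arcs E u) (edge_space E \<Phi>)) (span C) (vertex_space E \<Phi> u) \<and>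
      (finite (out_arcs E u) \<and> out_arcs E u \<noteq> {} \<longrightarrow> C = {}) \<and>
      (\<forall>e\<in>out_arcs E u. \<forall>x\<in>C. \<Phi> (lpa_ghost E e) x = 0)"
      by (rule ex_adapted_complement_basis[of u "Vbar u"])
        (use u Vbar Vbar_zero in \<open>auto simp: out_arcs_def\<close>)
  qed
  then obtain C where C: "\<forall>u\<in>verts E. independent (C u) \<and>
    is_complement sc (subspace_sum sc (out_arcs E u) (edge_space E \<Phi>)) (span (C u)) (vertex_space E \<Phi> u) \<and>
    (finite (out_arcs E u) \<and> out_arcs E u \<noteq> {} \<longrightarrow> C u = {}) \<and>
    (\<forall>e\<in>out_arcs E u. \<forall>x\<in>C u. \<Phi> (lpa_ghost E e) x = 0)"
    by (rule bchoice[THEN exE])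
  have main: "\<exists>(X :: 'a set) RR D f \<pi>.
      algebraic_branching_system E X RR D f \<and> is_induced_rep E X RR D f \<pi> \<and>
      equivalent_reps E finsupp_scale (finsupp_module X) \<pi> sc M \<Psi>"
    if "independent N" "is_complement sc W (span N) M"
      "\<And>u x. u \<in> verts E \<Longrightarrow> x \<in> N \<Longrightarrow> \<Phi> (lpa_vertex E u) x = 0"
      "\<And>a x. a \<in> lpa E \<Longrightarrow> x \<in> M \<Longrightarrow> \<Psi> a x = \<Phi> a x"
    for N M and \<Psi> :: "('k, 'v, 'e) lpa_term set \<Rightarrow> 'a \<Rightarrow> 'a"
  proof (rule equivalent_to_induced_rep[OF wf])
    show "\<Phi> (lpa_ghost E e) x = 0" if "e \<in> arcs E" "x \<in> C (tail E e)" for e x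
      using C[rule_format, of "tail E e"] that by (simp add: out_arcs_def)
    show "is_complement sc (rep_support E sc \<Phi>) (span N) M" using that(2) W by simp
  qed (use C that in auto)
  show ?thesis
  proof (intro conjI impI)
    have "is_complement sc W (span {}) W"
      using is_complement_0(1)[of W] Wbar by (simp add: is_complement_def)
    then show "\<exists>(X :: 'a set) RR D f \<pi>.
        algebraic_branching_system E X RR D f \<and> is_induced_rep E X RR D f \<pi> \<and>
        equivalent_reps E finsupp_scale (finsupp_module X) \<pi> sc W (restricted_rep \<Phi> W)"
      by (intro main[of "{}"]) (simp_all add: independent_empty restricted_rep_def)
  next
    assume zero: "\<forall>u\<in>verts E. \<forall>x\<in>Wbar. \<Phi> (lpa_vertex E u) x = 0"
    have "subspace Wbar" using Wbar by (simp add: is_complement_def)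
    then obtain N where N: "independent N" "span N = Wbar" using subspace_has_basis by blast
    then have "N \<subseteq> Wbar" using span_superset by blast
    then show "\<exists>(X :: 'a set) RR D f \<pi>.
        algebraic_branching_system E X RR D f \<and> is_induced_rep E X RR D f \<pi> \<and>
        equivalent_reps E finsupp_scale (finsupp_module X) \<pi> sc UNIV \<Phi>"
      using zero N Wbar by (intro main[of N]) auto
  qed
qed

end
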